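(* There does not exist an essential, natural, regular uniform algebra generated by $C^1$-smooth functions on a compact two-dimensional $C^1$-manifold-with-boundary. That is, if $M$ is a compact two-dimensional $C^1$-manifold-with-boundary, then there is no uniform algebra $A$ on $M$ that is essential, natural and regular and that is generated by a collection of $C^1$-smooth complex-valued functions on $M$.
   Context: Compact spaces are taken to be non-empty and Hausdorff. For a compact space $X$, $C(X)$ is the algebra of all continuous complex-valued functions on $X$ with the supremum norm. A uniform algebra on $X$ is a closed subalgebra of $C(X)$ that contains the constant functions and separates the points of $X$. Let $A$ be a uniform algebra on $X$. A collection of functions $F\subseteq A$ generates $A$ if the collection of all polynomials in the functions in $F$ is a dense subset of $A$. The essential set for $A$ is the smallest closed subset $E$ of $X$ such that $A$ contains every continuous function on $X$ that vanishes on $E$; $A$ is essential if its essential set is $X$. $A$ is natural (on $X$) if the only non-zero multiplicative linear functionals on $A$ are the evaluations at the points of $X$. $A$ is regular on $X$ if, for each closed subset $E\subseteq X$ and each $x\in X\setminus E$, there is $f\in A$ with $f(x)=1$ and $f(E)\subseteq\{0\}$; $A$ is regular if it is natural and regular on $X$. *)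

theory Defs
  imports "HOL-Analysis.Analysis"
begin

section \<open>Uniform algebras\<close>

definition compact_Hausdorff :: "'a topology \<Rightarrow> bool" where
  "compact_Hausdorff X \<longleftrightarrow> topspace X \<noteq> {} \<and> compact_space X \<and> Hausdorff_space X"

text \<open>
  C(X) as a metric space under the supremum metric. Its elements are extensional, i.e. undefined
  off the space, so equality of elements is equality of functions on the space; accordingly the
  pointwise operations below are restricted to the space.
\<close>

abbreviation C_space :: "'a topology \<Rightarrow> ('a \<Rightarrow> complex) metric" where
  "C_space X \<equiv> cfunspace X euclidean_metric"

lemma mspace_C_space:
  assumes "compact_space X"
  shows "mspace (C_space X) = {f. continuous_map X euclidean f \<and> f \<in> extensional (topspace X)}"
proof -
  have "Met_TC.mbounded (f ` topspace X)" if "continuous_map X euclidean f" for f :: "'a \<Rightarrow> complex"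
  proof -
    have "bounded (f ` topspace X)"
      using image_compactin[OF _ that, of "topspace X"] assms
      by (auto simp: compact_space_def compact_imp_bounded)
    then show ?thesis
      by (auto simp: Met_TC.mbounded_def bounded_def Met_TC.mcball_def subset_iff)
  qed
  then show ?thesis
    by auto
qed

definition const_on :: "'a topology \<Rightarrow> complex \<Rightarrow> 'a \<Rightarrow> complex" where
  "const_on X c = restrict (\<lambda>x. c) (topspace X)"

definition add_on :: "'a topology \<Rightarrow> ('a \<Rightarrow> complex) \<Rightarrow> ('a \<Rightarrow> complex) \<Rightarrow> 'a \<Rightarrow> complex" where
  "add_on X f g = restrict (\<lambda>x. f x + g x) (topspace X)"

definition mult_on :: "'a topology \<Rightarrow> ('a \<Rightarrow> complex) \<Rightarrow> ('a \<Rightarrow> complex) \<Rightarrow> 'a \<Rightarrow> complex" where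
  "mult_on X f g = restrict (\<lambda>x. f x * g x) (topspace X)"

definition scale_on :: "'a topology \<Rightarrow> complex \<Rightarrow> ('a \<Rightarrow> complex) \<Rightarrow> 'a \<Rightarrow> complex" where
  "scale_on X c f = restrict (\<lambda>x. c * f x) (topspace X)"

definition subalgebra_of_C :: "'a topology \<Rightarrow> ('a \<Rightarrow> complex) set \<Rightarrow> bool" where
  "subalgebra_of_C X A \<longleftrightarrow>
     A \<subseteq> mspace (C_space X) \<and> A \<noteq> {} \<and>
     (\<forall>f\<in>A. \<forall>g\<in>A. add_on X f g \<in> A \<and> mult_on X f g \<in> A) \<and>
     (\<forall>c. \<forall>f\<in>A. scale_on X c f \<in> A)"

definition uniform_algebra :: "'a topology \<Rightarrow> ('a \<Rightarrow> complex) set \<Rightarrow> bool" where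
  "uniform_algebra X A \<longleftrightarrow>
     compact_Hausdorff X \<and>
     subalgebra_of_C X A \<and>
     closedin (mtopology_of (C_space X)) A \<and>
     (\<forall>c. const_on X c \<in> A) \<and>
     (\<forall>x\<in>topspace X. \<forall>y\<in>topspace X. x \<noteq> y \<longrightarrow> (\<exists>f\<in>A. f x \<noteq> f y))"

text \<open>
  All polynomials in finitely many members of \<^term>\<open>F\<close>: for a finite \<^term>\<open>G \<subseteq> F\<close>, a
  multi-index assigns an exponent to each \<^term>\<open>g \<in> G\<close>, and \<^term>\<open>I\<close> is the finite set of
  multi-indices of the monomials occurring.
\<close>

definition polynomials_in ::
  "'a topology \<Rightarrow> ('a \<Rightarrow> complex) set \<Rightarrow> ('a \<Rightarrow> complex) set" where
  "polynomials_in X F =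
     {restrict (\<lambda>x. \<Sum>m\<in>I. c m * (\<Prod>g\<in>G. g x ^ m g)) (topspace X) |
        G (I :: (('a \<Rightarrow> complex) \<Rightarrow> nat) set) (c :: (('a \<Rightarrow> complex) \<Rightarrow> nat) \<Rightarrow> complex).
        finite G \<and> G \<subseteq> F \<and> finite I}"

definition generates ::
  "'a topology \<Rightarrow> ('a \<Rightarrow> complex) set \<Rightarrow> ('a \<Rightarrow> complex) set \<Rightarrow> bool" where
  "generates X F A \<longleftrightarrow>
     F \<subseteq> A \<and> polynomials_in X F \<subseteq> A \<and>
     A \<subseteq> mtopology_of (C_space X) closure_of (polynomials_in X F)"

definition contains_all_vanishing_on ::
  "'a topology \<Rightarrow> ('a \<Rightarrow> complex) set \<Rightarrow> 'a set \<Rightarrow> bool" where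
  "contains_all_vanishing_on X A E \<longleftrightarrow>
     (\<forall>f\<in>mspace (C_space X). (\<forall>x\<in>E. f x = 0) \<longrightarrow> f \<in> A)"

definition is_essential_set ::
  "'a topology \<Rightarrow> ('a \<Rightarrow> complex) set \<Rightarrow> 'a set \<Rightarrow> bool" where
  "is_essential_set X A E \<longleftrightarrow>
     closedin X E \<and> contains_all_vanishing_on X A E \<and>
     (\<forall>E'. closedin X E' \<and> contains_all_vanishing_on X A E' \<longrightarrow> E \<subseteq> E')"

definition essential_algebra :: "'a topology \<Rightarrow> ('a \<Rightarrow> complex) set \<Rightarrow> bool" where
  "essential_algebra X A \<longleftrightarrow> is_essential_set X A (topspace X)"

text \<open>Functionals on \<^term>\<open>A\<close>; their values off \<^term>\<open>A\<close> are irrelevant.\<close>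

definition multiplicative_functional ::
  "'a topology \<Rightarrow> ('a \<Rightarrow> complex) set \<Rightarrow> (('a \<Rightarrow> complex) \<Rightarrow> complex) \<Rightarrow> bool" where
  "multiplicative_functional X A \<phi> \<longleftrightarrow>
     (\<forall>f\<in>A. \<forall>g\<in>A. \<phi> (add_on X f g) = \<phi> f + \<phi> g) \<and>
     (\<forall>c. \<forall>f\<in>A. \<phi> (scale_on X c f) = c * \<phi> f) \<and>
     (\<forall>f\<in>A. \<forall>g\<in>A. \<phi> (mult_on X f g) = \<phi> f * \<phi> g)"

definition natural_algebra :: "'a topology \<Rightarrow> ('a \<Rightarrow> complex) set \<Rightarrow> bool" where
  "natural_algebra X A \<longleftrightarrow>
     (\<forall>\<phi>. multiplicative_functional X A \<phi> \<and> (\<exists>f\<in>A. \<phi> f \<noteq> 0) \<longrightarrow>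
          (\<exists>x\<in>topspace X. \<forall>f\<in>A. \<phi> f = f x))"

definition regular_on :: "'a topology \<Rightarrow> ('a \<Rightarrow> complex) set \<Rightarrow> bool" where
  "regular_on X A \<longleftrightarrow>
     (\<forall>E x. closedin X E \<and> x \<in> topspace X - E \<longrightarrow> (\<exists>f\<in>A. f x = 1 \<and> f ` E \<subseteq> {0}))"

definition regular_algebra :: "'a topology \<Rightarrow> ('a \<Rightarrow> complex) set \<Rightarrow> bool" where
  "regular_algebra X A \<longleftrightarrow> natural_algebra X A \<and> regular_on X A"


section \<open>Two-dimensional \<open>C\<^sup>1\<close>-manifolds-with-boundary\<close>

definition half_plane :: "(real^2) set" where
  "half_plane = {p. p $ 2 \<ge> 0}"

definition C1_on_open :: "(real^2) set \<Rightarrow> (real^2 \<Rightarrow> 'b::real_normed_vector) \<Rightarrow> bool" where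
  "C1_on_open V f \<longleftrightarrow>
     (\<exists>f' :: real^2 \<Rightarrow> (real^2) \<Rightarrow>\<^sub>L 'b.
        (\<forall>p\<in>V. (f has_derivative blinfun_apply (f' p)) (at p)) \<and> continuous_on V f')"

text \<open>
  On sets that are not open in the plane, such as images of charts at the boundary,
  \<open>C\<^sup>1\<close> means being locally the restriction of a \<open>C\<^sup>1\<close> map defined on an open subset of the plane.
\<close>

definition C1_on :: "(real^2) set \<Rightarrow> (real^2 \<Rightarrow> 'b::real_normed_vector) \<Rightarrow> bool" where
  "C1_on W f \<longleftrightarrow>
     (\<forall>p\<in>W. \<exists>V g. open V \<and> p \<in> V \<and> C1_on_open V g \<and> (\<forall>q\<in>W \<inter> V. g q = f q))"

text \<open>A chart is given as a pair of its domain and the coordinate map.\<close>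

type_synonym 'a chart = "'a set \<times> ('a \<Rightarrow> real^2)"

definition is_chart :: "'a topology \<Rightarrow> 'a chart \<Rightarrow> bool" where
  "is_chart M = (\<lambda>(U, \<phi>).
     openin M U \<and> openin (top_of_set half_plane) (\<phi> ` U) \<and>
     homeomorphic_map (subtopology M U) (top_of_set (\<phi> ` U)) \<phi>)"

text \<open>
  Only one of the two transition maps; \<open>C1_atlas\<close> below imposes this on all ordered pairs of charts.
\<close>

definition C1_compatible :: "'a chart \<Rightarrow> 'a chart \<Rightarrow> bool" where
  "C1_compatible = (\<lambda>(U, \<phi>) (V, \<psi>). C1_on (\<phi> ` (U \<inter> V)) (\<psi> \<circ> inv_into U \<phi>))"

definition C1_atlas :: "'a topology \<Rightarrow> 'a chart set \<Rightarrow> bool" where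
  "C1_atlas M \<A> \<longleftrightarrow>
     (\<forall>\<kappa>\<in>\<A>. is_chart M \<kappa>) \<and>
     (\<Union>\<kappa>\<in>\<A>. fst \<kappa>) = topspace M \<and>
     (\<forall>\<kappa>\<in>\<A>. \<forall>\<kappa>'\<in>\<A>. C1_compatible \<kappa> \<kappa>')"

text \<open>
  The \<open>C\<^sup>1\<close>-structure is the one determined by the atlas, which need not be maximal; passing to
  the maximal atlas does not change the \<open>C\<^sup>1\<close>-smooth functions. The boundary may be empty.
\<close>

definition C1_surface_with_boundary :: "'a topology \<Rightarrow> 'a chart set \<Rightarrow> bool" where
  "C1_surface_with_boundary M \<A> \<longleftrightarrow>
     Hausdorff_space M \<and> second_countable M \<and> C1_atlas M \<A>"

definition C1_smooth :: "'a chart set \<Rightarrow> ('a \<Rightarrow> complex) \<Rightarrow> bool" where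
  "C1_smooth \<A> f \<longleftrightarrow> (\<forall>(U, \<phi>)\<in>\<A>. C1_on (\<phi> ` U) (f \<circ> inv_into U \<phi>))"

end

theory Submission
  imports Defs "HOL-Complex_Analysis.Complex_Analysis"
begin

text \<open>
  Everything happens in one chart, away from the boundary, with coordinate \<open>z\<close> in an open subset
  of the complex plane. If two generators \<open>f\<close>, \<open>g\<close> satisfy \<open>df \<and> dg \<noteq> 0\<close> at a point, then
  linear combinations of them are small Lipschitz perturbations of \<open>Re z\<close> and \<open>Im z\<close> nearby, and
  approximate partitions of unity made of complex Gaussians in these combinations show that the
  algebra is dense in the continuous functions on a small disc; multiplying by a bump function,
  which regularity provides, the algebra contains all continuous functions supported in some
  nonempty open set, so it is not essential. If instead all these wedge products vanish and some
  generator \<open>f\<close> has nonzero Jacobian at a point, then all members of the algebra are locally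
  holomorphic functions of \<open>f\<close>, which contradicts regularity by the identity theorem. If all
  Jacobians vanish too, then all generators are constant along the level curves of one real
  function, so the algebra does not separate points.
\<close>

section \<open>Closed algebras of functions\<close>

text \<open>Members are total functions, but boundedness and closure refer to \<open>K\<close> only.
  Hence functions that agree on \<open>K\<close> are interchangeable (\<open>cong\<close>), and no
  restriction operator is carried along.\<close>

locale closed_function_algebra =
  fixes K :: "'b set" and B :: "('b \<Rightarrow> complex) set"
  assumes const: "(\<lambda>_. c) \<in> B"
    and add: "\<lbrakk>f \<in> B; g \<in> B\<rbrakk> \<Longrightarrow> (\<lambda>x. f x + g x) \<in> B"
    and mult: "\<lbrakk>f \<in> B; g \<in> B\<rbrakk> \<Longrightarrow> (\<lambda>x. f x * g x) \<in> B"
    and bounded: "f \<in> B \<Longrightarrow> \<exists>b. \<forall>x\<in>K. norm (f x) \<le> b"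
    and closed: "(\<And>e. e > 0 \<Longrightarrow> \<exists>g\<in>B. \<forall>x\<in>K. norm (f x - g x) < e) \<Longrightarrow> f \<in> B"
begin

lemma cong: "\<lbrakk>f \<in> B; \<And>x. x \<in> K \<Longrightarrow> g x = f x\<rbrakk> \<Longrightarrow> g \<in> B"
  by (rule closed) (metis norm_zero right_minus_eq)

lemma uminus: "f \<in> B \<Longrightarrow> (\<lambda>x. - f x) \<in> B"
  using mult [OF const [of "-1"], of f] by simp

lemma diff: "\<lbrakk>f \<in> B; g \<in> B\<rbrakk> \<Longrightarrow> (\<lambda>x. f x - g x) \<in> B"
  using add [OF _ uminus, of f g] by simp

lemma power: "f \<in> B \<Longrightarrow> (\<lambda>x. f x ^ n) \<in> B"
  by (induction n) (auto intro: const mult)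

lemma divide_const: "f \<in> B \<Longrightarrow> (\<lambda>x. f x / c) \<in> B"
  using mult [OF const [of "inverse c"], of f] by (simp add: field_simps)

lemma sum: "(\<And>i. i \<in> I \<Longrightarrow> f i \<in> B) \<Longrightarrow> (\<lambda>x. \<Sum>i\<in>I. f i x) \<in> B"
  by (induction I rule: infinite_finite_induct) (auto intro: const add)

text \<open>The Taylor polynomials of the exponential converge uniformly on the bounded set of
  values that \<open>f\<close> takes on \<open>K\<close>.\<close>

lemma exp:
  assumes f: "f \<in> B"
  shows "(\<lambda>x. exp (f x)) \<in> B"
proof (rule closed)
  fix e :: real assume e: "e > 0"
  obtain b where b: "\<And>x. x \<in> K \<Longrightarrow> norm (f x) \<le> b"
    using bounded [OF f] by blast
  have "(\<lambda>n. inverse (fact n) *\<^sub>R \<bar>b\<bar> ^ n) \<longlonglongrightarrow> 0"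
    by (rule summable_LIMSEQ_zero [OF summable_exp_generic])
  \<comment> \<open>The extra factor turns the general term of the exponential series into the
    remainder bound of \<open>Taylor_exp\<close>. The absolute value is there because an empty
    \<open>K\<close> says nothing about the sign of \<open>b\<close>.\<close>
  then have "(\<lambda>n. (exp \<bar>b\<bar> * \<bar>b\<bar>) * (inverse (fact n) *\<^sub>R \<bar>b\<bar> ^ n)) \<longlonglongrightarrow> 0"
    by (rule tendsto_mult_right_zero)
  then have "eventually (\<lambda>n. (exp \<bar>b\<bar> * \<bar>b\<bar>) * (inverse (fact n) *\<^sub>R \<bar>b\<bar> ^ n) < e) sequentially"
    using e by (rule order_tendstoD)
  then obtain n where n: "(exp \<bar>b\<bar> * \<bar>b\<bar>) * (inverse (fact n) *\<^sub>R \<bar>b\<bar> ^ n) < e"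
    by (auto simp: eventually_sequentially)
  let ?g = "\<lambda>x. \<Sum>i\<le>n. f x ^ i / fact i"
  have "?g \<in> B"
    by (intro sum divide_const power f)
  moreover have "norm (exp (f x) - ?g x) < e" if "x \<in> K" for x
  proof -
    have fb: "norm (f x) \<le> \<bar>b\<bar>"
      using b [OF that] by linarith
    have "norm (exp (f x) - ?g x) \<le> exp \<bar>Re (f x)\<bar> * norm (f x) ^ Suc n / fact n"
      by (rule Taylor_exp)
    also have "\<dots> \<le> exp \<bar>b\<bar> * \<bar>b\<bar> ^ Suc n / fact n"
      using fb abs_Re_le_cmod [of "f x"]
      by (intro divide_right_mono mult_mono power_mono) auto
    also have "\<dots> = (exp \<bar>b\<bar> * \<bar>b\<bar>) * (inverse (fact n) *\<^sub>R \<bar>b\<bar> ^ n)"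
      by (simp add: field_simps)
    finally show ?thesis
      using n by linarith
  qed
  ultimately show "\<exists>g\<in>B. \<forall>x\<in>K. norm (exp (f x) - g x) < e"
    by (intro bexI [of _ ?g] ballI)
qed

text \<open>The values of \<open>f\<close> on \<open>K\<close> lie in a disc about a large real
  \<open>T\<close> that stays away from 0. So \<open>u = 1 - f / T\<close> is uniformly smaller than
  1 in modulus, and \<open>1 / f\<close> is \<open>1 / T\<close> times the geometric series in
  \<open>u\<close>.\<close>

lemma inverse:
  assumes f: "f \<in> B" and m: "m > 0" "\<And>x. x \<in> K \<Longrightarrow> Re (f x) \<ge> m"
  shows "(\<lambda>x. 1 / f x) \<in> B"
proof -
  obtain b where b: "\<And>x. x \<in> K \<Longrightarrow> norm (f x) \<le> b"
    using bounded [OF f] by blast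
  \<comment> \<open>Chosen so that \<open>b\<^sup>2 \<le> m * T\<close>, which gives
    \<open>(norm (u x))\<^sup>2 \<le> 1 - m / T\<close>; the summand 1 keeps \<open>T\<close>
    positive when \<open>b = 0\<close>.\<close>
  define T where "T = b\<^sup>2 / m + 1"
  have T: "T > 0" "b\<^sup>2 \<le> m * T"
    using m(1) by (auto simp: T_def divide_nonneg_pos add_nonneg_pos ring_distribs)
  \<comment> \<open>If \<open>K\<close> has a point then \<open>m \<le> b\<close>, so
    \<open>m < T\<close>; the maximum with 0 matters only for empty \<open>K\<close>.\<close>
  define q where "q = sqrt (max 0 (1 - m / T))"
  have q: "0 \<le> q" "q < 1"
    using T m(1) by (auto simp: q_def)
  define u where "u = (\<lambda>x. 1 - f x / of_real T)"
  have uB: "u \<in> B"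
    unfolding u_def by (intro diff const divide_const f)
  have uq: "norm (u x) \<le> q" if "x \<in> K" for x
  proof -
    have "(norm (f x))\<^sup>2 \<le> b\<^sup>2"
      using b [OF that] by (intro power_mono) auto
    then have 1: "(Re (f x))\<^sup>2 + (Im (f x))\<^sup>2 \<le> m * T"
      using T by (simp add: cmod_power2)
    have "(norm (u x))\<^sup>2 = (1 - Re (f x) / T)\<^sup>2 + (Im (f x) / T)\<^sup>2"
      by (simp add: u_def cmod_power2)
    also have "\<dots> = 1 - 2 * Re (f x) / T + ((Re (f x))\<^sup>2 + (Im (f x))\<^sup>2) / T\<^sup>2"
      using T by (simp add: field_simps power2_eq_square)
    also have "\<dots> \<le> 1 - 2 * m / T + (m * T) / T\<^sup>2"
      using 1 m(2) [OF that] T(1) by (intro add_mono diff_mono divide_right_mono) auto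
    also have "\<dots> = 1 - m / T"
      using T by (simp add: field_simps power2_eq_square)
    finally show ?thesis
      unfolding q_def by (intro real_le_rsqrt) auto
  qed
  have "(\<lambda>x. 1 / (1 - u x)) \<in> B"
  proof (rule closed)
    fix e :: real assume e: "e > 0"
    have "(\<lambda>n. q ^ n / (1 - q)) \<longlonglongrightarrow> 0 / (1 - q)"
      using q by (intro tendsto_intros LIMSEQ_power_zero) auto
    then have "eventually (\<lambda>n. q ^ n / (1 - q) < e) sequentially"
      using e by (intro order_tendstoD) auto
    then obtain n where n: "q ^ n / (1 - q) < e"
      by (auto simp: eventually_sequentially)
    have "norm (1 / (1 - u x) - (\<Sum>i<n. u x ^ i)) < e" if "x \<in> K" for x
    proof -
      have u1: "u x \<noteq> 1"
        using uq [OF that] q by auto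
      have "1 / (1 - u x) - (\<Sum>i<n. u x ^ i) = u x ^ n / (1 - u x)"
        using u1 by (simp add: sum_gp_strict diff_divide_distrib [symmetric])
      also have "norm \<dots> \<le> q ^ n / (1 - q)"
        unfolding norm_divide norm_power
        using uq [OF that] q norm_triangle_ineq2 [of 1 "u x"]
        by (intro frac_le power_mono) auto
      finally show ?thesis
        using n by linarith
    qed
    moreover have "(\<lambda>x. \<Sum>i<n. u x ^ i) \<in> B"
      by (intro sum power uB)
    ultimately show "\<exists>g\<in>B. \<forall>x\<in>K. norm (1 / (1 - u x) - g x) < e"
      by (intro bexI [of _ "\<lambda>x. \<Sum>i<n. u x ^ i"] ballI)
  qed
  then have "(\<lambda>x. (1 / (1 - u x)) / of_real T) \<in> B"
    by (rule divide_const)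
  then show ?thesis
    by (rule cong) (use T in \<open>auto simp: u_def\<close>)
qed

end

section \<open>Estimates for Gaussian sums over the integer lattice\<close>

text \<open>On either side of \<open>t\<close> the terms are dominated by a geometric series of
  ratio \<open>exp (-1) \<le> 1/2\<close>, whose sum is at most 2. The bound is uniform in
  \<open>t\<close> and \<open>J\<close>.\<close>

lemma sum_exp_neg_dist_int:
  fixes t :: real
  assumes "finite J"
  shows "(\<Sum>j\<in>J. exp (- \<bar>t - of_int j\<bar>)) \<le> 4"
proof -
  let ?q = "exp (-1) :: real"
  have q: "0 < ?q" "?q \<le> 1/2"
    using exp_ge_add_one_self [of "1::real"] by (auto simp: exp_minus field_simps)
  have geo: "(\<Sum>j\<in>I. ?q ^ nat (f j)) \<le> 2" if "finite I" "inj_on f I" "\<And>j. j \<in> I \<Longrightarrow> f j \<ge> 0"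
    for I :: "int set" and f :: "int \<Rightarrow> int"
  proof -
    have "inj_on (\<lambda>j. nat (f j)) I"
      using that by (auto simp: inj_on_def eq_nat_nat_iff)
    then have "(\<Sum>j\<in>I. ?q ^ nat (f j)) = (\<Sum>k\<in>(\<lambda>j. nat (f j)) ` I. ?q ^ k)"
      by (simp add: sum.reindex)
    also have "\<dots> \<le> (\<Sum>k. ?q ^ k)"
      using that q by (intro sum_le_suminf) (auto intro!: summable_geometric)
    also have "\<dots> = 1 / (1 - ?q)"
      using q by (intro suminf_geometric) auto
    also have "\<dots> \<le> 2"
      using q by (simp add: field_simps)
    finally show ?thesis .
  qed
  let ?L = "{j\<in>J. j \<le> \<lfloor>t\<rfloor>}" and ?R = "{j\<in>J. j > \<lfloor>t\<rfloor>}"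
  have pow: "?q ^ nat k = exp (- of_int k)" if "k \<ge> 0" for k
    using that by (simp flip: exp_of_nat_mult)
  have "(\<Sum>j\<in>?L. exp (- \<bar>t - of_int j\<bar>)) \<le> (\<Sum>j\<in>?L. ?q ^ nat (\<lfloor>t\<rfloor> - j))"
    by (rule sum_mono) (subst pow; auto; linarith)
  also have "\<dots> \<le> 2"
    using assms by (intro geo) (auto simp: inj_on_def)
  finally have 1: "(\<Sum>j\<in>?L. exp (- \<bar>t - of_int j\<bar>)) \<le> 2" .
  \<comment> \<open>The integers to the right of \<open>t\<close> start at
    \<open>\<lfloor>t\<rfloor> + 1\<close>, so the shift by 1 lets the exponents start at 0.\<close>
  have "(\<Sum>j\<in>?R. exp (- \<bar>t - of_int j\<bar>)) \<le> (\<Sum>j\<in>?R. ?q ^ nat (j - \<lfloor>t\<rfloor> - 1))"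
    by (rule sum_mono) (subst pow; auto; linarith)
  also have "\<dots> \<le> 2"
    using assms by (intro geo) (auto simp: inj_on_def)
  finally have 2: "(\<Sum>j\<in>?R. exp (- \<bar>t - of_int j\<bar>)) \<le> 2" .
  have "J = ?L \<union> ?R" "?L \<inter> ?R = {}"
    by auto
  then have "(\<Sum>j\<in>J. exp (- \<bar>t - of_int j\<bar>)) =
      (\<Sum>j\<in>?L. exp (- \<bar>t - of_int j\<bar>)) + (\<Sum>j\<in>?R. exp (- \<bar>t - of_int j\<bar>))"
    using assms by (metis (no_types, lifting) finite_Un sum.union_disjoint)
  then show ?thesis
    using 1 2 by linarith
qed

text \<open>The linear part of the weight will absorb a Lipschitz error and the quadratic part a
  perturbation of the exponent. The Gaussian beats \<open>exp (- (2 * s))\<close>, which is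
  dominated by a product of one-dimensional kernels.\<close>

lemma sum_lattice_gaussian:
  assumes "finite J"
  shows "(\<Sum>(j, k)\<in>J. (norm (w - Complex (of_int j) (of_int k)) + (norm (w - Complex (of_int j) (of_int k)))\<^sup>2) *
            exp (- (norm (w - Complex (of_int j) (of_int k)))\<^sup>2 / 2)) \<le> 32 * exp (9/2)"
proof -
  have kernel: "(s + s\<^sup>2) * exp (- s\<^sup>2 / 2) \<le> 2 * exp (9/2) * exp (- (2 * s))" if "s \<ge> 0" for s :: real
  proof -
    have "s + s\<^sup>2 \<le> 2 * exp s"
      using exp_lower_Taylor_quadratic [OF that] that by linarith
    then have "(s + s\<^sup>2) * exp (- s\<^sup>2 / 2) \<le> 2 * exp s * exp (- s\<^sup>2 / 2)"
      by (intro mult_right_mono) auto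
    also have "\<dots> = 2 * exp (s - s\<^sup>2 / 2)"
      by (simp flip: exp_add)
    \<comment> \<open>The comparison of exponents is \<open>(s - 3)\<^sup>2 \<ge> 0\<close>, the
      source of the constant 9/2.\<close>
    also have "\<dots> \<le> 2 * exp (9/2 - 2 * s)"
      using zero_le_power2 [of "s - 3"] by (simp add: power2_eq_square algebra_simps)
    also have "\<dots> = 2 * exp (9/2) * exp (- (2 * s))"
      by (simp flip: exp_add)
    finally show ?thesis .
  qed
  let ?e1 = "\<lambda>j. exp (- \<bar>Re w - of_int j\<bar>)" and ?e2 = "\<lambda>k. exp (- \<bar>Im w - of_int k\<bar>)"
  have "(\<Sum>(j, k)\<in>J. (norm (w - Complex (of_int j) (of_int k)) + (norm (w - Complex (of_int j) (of_int k)))\<^sup>2) *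
            exp (- (norm (w - Complex (of_int j) (of_int k)))\<^sup>2 / 2))
      \<le> (\<Sum>(j, k)\<in>J. 2 * exp (9/2) * (?e1 j * ?e2 k))"
  proof (intro sum_mono, clarify)
    fix j k :: int
    let ?v = "w - Complex (of_int j) (of_int k)"
    have "\<bar>Re ?v\<bar> + \<bar>Im ?v\<bar> \<le> 2 * norm ?v"
      using abs_Re_le_cmod [of ?v] abs_Im_le_cmod [of ?v] by linarith
    then have "exp (- (2 * norm ?v)) \<le> ?e1 j * ?e2 k"
      by (simp flip: exp_add)
    then show "(norm ?v + (norm ?v)\<^sup>2) * exp (- (norm ?v)\<^sup>2 / 2) \<le> 2 * exp (9/2) * (?e1 j * ?e2 k)"
      using kernel [of "norm ?v"] by (smt (verit) exp_gt_zero mult_left_mono norm_ge_zero)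
  qed
  \<comment> \<open>Enlarging \<open>J\<close> to the product of its projections lets the double sum
    factor.\<close>
  also have "\<dots> \<le> (\<Sum>(j, k)\<in>fst ` J \<times> snd ` J. 2 * exp (9/2) * (?e1 j * ?e2 k))"
    using assms by (intro sum_mono2) (force simp: image_iff)+
  also have "\<dots> = 2 * exp (9/2) * ((\<Sum>j\<in>fst ` J. ?e1 j) * (\<Sum>k\<in>snd ` J. ?e2 k))"
    by (subst sum_product) (simp add: sum_distrib_left sum.cartesian_product split_def)
  also have "\<dots> \<le> 2 * exp (9/2) * (4 * 4)"
    using assms by (intro mult_left_mono mult_mono sum_exp_neg_dist_int) (auto intro: sum_nonneg)
  finally show ?thesis
    by simp
qed

text \<open>Controls a real Gaussian \<open>exp t\<close> whose exponent is perturbed by a complex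
  \<open>a\<close>: after \<open>exp t\<close> is factored out, this is the Taylor estimate of order
  0 at \<open>a\<close>.\<close>

lemma norm_exp_diff_le:
  fixes a :: complex and t :: real
  shows "norm (exp (a + of_real t) - exp (of_real t)) \<le> norm a * exp (norm a + t)"
proof -
  have "norm (exp a - (\<Sum>i\<le>0. a ^ i / fact i)) \<le> exp \<bar>Re a\<bar> * norm a ^ Suc 0 / fact 0"
    by (rule Taylor_exp)
  then have "norm (exp a - 1) \<le> norm a * exp \<bar>Re a\<bar>"
    by (simp add: mult.commute)
  also have "\<dots> \<le> norm a * exp (norm a)"
    using abs_Re_le_cmod by (intro mult_left_mono) auto
  finally have 1: "norm (exp a - 1) \<le> norm a * exp (norm a)" .
  have "norm (exp (a + of_real t) - exp (of_real t)) = norm (exp a - 1) * exp t"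
  proof -
    have "exp (a + of_real t) - exp (of_real t) = (exp a - 1) * of_real (exp t)"
      by (simp add: exp_add algebra_simps exp_of_real)
    then show ?thesis
      by (simp add: norm_mult)
  qed
  also have "\<dots> \<le> norm a * exp (norm a) * exp t"
    using 1 by (intro mult_right_mono) auto
  finally show ?thesis
    by (simp add: exp_add mult.assoc)
qed

section \<open>Approximation by complex Gaussians and Stone-Weierstrass\<close>

text \<open>
  The normalised lattice sum \<open>(\<Sum>\<^sub>j h(a\<^sub>j) G\<^sub>j) / (\<Sum>\<^sub>j G\<^sub>j)\<close>, where \<open>G\<^sub>j\<close> is the complex Gaussian
  \<open>exp (- ((P - P(a\<^sub>j))\<^sup>2 + (Q - Q(a\<^sub>j))\<^sup>2) / \<delta>\<^sup>2)\<close> and \<open>a\<^sub>j\<close> runs through the points of the lattice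
  with mesh \<open>\<delta>\<close> in the large disc, converges to \<open>h\<close> as \<open>\<delta>\<close> tends to 0. The value of \<open>\<epsilon>\<close>
  keeps the denominator close to the corresponding sum of real Gaussians, hence away from 0: it
  makes \<open>6\<epsilon>\<close> times the bound in \<open>sum_lattice_gaussian\<close> at most \<open>exp (-1/2) / 2\<close>.
\<close>

lemma (in closed_function_algebra) lipschitz_mem:
  fixes P Q :: "complex \<Rightarrow> complex" and X :: "'b \<Rightarrow> complex"
  defines "\<epsilon> \<equiv> exp (-5) / 400"
  assumes r: "r > 0" and X: "\<And>x. x \<in> K \<Longrightarrow> X x \<in> cball p r"
    and P: "(\<lambda>x. P (X x)) \<in> B" and Q: "(\<lambda>x. Q (X x)) \<in> B"
    and P_lip: "\<And>x y. \<lbrakk>x \<in> cball p (2 * r); y \<in> cball p (2 * r)\<rbrakk> \<Longrightarrow>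
                 norm (P x - P y - of_real (Re (x - y))) \<le> \<epsilon> * norm (x - y)"
    and Q_lip: "\<And>x y. \<lbrakk>x \<in> cball p (2 * r); y \<in> cball p (2 * r)\<rbrakk> \<Longrightarrow>
                 norm (Q x - Q y - of_real (Im (x - y))) \<le> \<epsilon> * norm (x - y)"
    and h: "\<And>x y. norm (h x - h y) \<le> L * norm (x - y)"
  shows "(\<lambda>x. h (X x)) \<in> B"
proof (rule closed)
  fix e :: real assume e: "e > 0"
  define C :: real where "C = 32 * exp (9/2)"
  define m :: real where "m = exp (-1/2) / 2"
  have Cm: "C > 0" "m > 0"
    by (auto simp: C_def m_def)
  have L: "L \<ge> 0"
    using order_trans [OF norm_ge_zero h [of 1 0]] by simp
  have \<epsilon>: "0 < \<epsilon>" "\<epsilon> \<le> 1/12" "6 * \<epsilon> * C \<le> m"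
  proof -
    have "exp (-5) \<le> (1::real)"
      by simp
    then have "3 * exp (-5) \<le> (100::real)"
      by linarith
    then show "0 < \<epsilon>" "\<epsilon> \<le> 1/12"
      unfolding \<epsilon>_def by auto
    have "exp (-5) * exp (9/2) = (exp (-1/2) :: real)"
      by (simp flip: exp_add)
    then show "6 * \<epsilon> * C \<le> m"
      unfolding \<epsilon>_def C_def m_def by simp
  qed
  \<comment> \<open>The bound by \<open>r\<close> keeps the lattice point nearest to a point of the
    small disc inside the large one. The other bound makes the final error
    \<open>L * C * \<delta> / m\<close> less than \<open>e\<close>; adding 1 covers
    \<open>L = 0\<close>.\<close>
  define \<delta> where "\<delta> = min r (e * m / (2 * (L * C + 1)))"
  have \<delta>: "\<delta> > 0" "\<delta> \<le> r" "L * C * \<delta> < e * m"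
  proof -
    have LC: "L * C \<ge> 0"
      using L Cm by simp
    show "\<delta> > 0" "\<delta> \<le> r"
      using r e Cm LC by (auto simp: \<delta>_def)
    have "L * C * \<delta> \<le> L * C * (e * m / (2 * (L * C + 1)))"
      using LC by (intro mult_left_mono) (auto simp: \<delta>_def)
    also have "\<dots> = e * m * (L * C / (2 * (L * C + 1)))"
      by simp
    also have "\<dots> < e * m * 1"
      using LC e Cm by (intro mult_strict_left_mono) (auto simp: add_nonneg_pos mult.commute divide_less_eq)
    finally show "L * C * \<delta> < e * m" by simp
  qed
  define a where "a = (\<lambda>(j, k). of_real \<delta> * Complex (of_int j) (of_int k))"
  define J where "J = {jk. a jk \<in> cball p (2 * r)}"
  \<comment> \<open>The displacement from the lattice point to \<open>x\<close> in units of the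
    mesh; \<open>q\<close> is the exponent of the complex Gaussian and approximates
    \<open>(norm (v x jk))\<^sup>2\<close>.\<close>
  define v where "v = (\<lambda>x jk. x / of_real \<delta> - Complex (of_int (fst jk)) (of_int (snd jk)))"
  define q where "q = (\<lambda>x jk. ((P x - P (a jk))\<^sup>2 + (Q x - Q (a jk))\<^sup>2) / (of_real \<delta>)\<^sup>2)"
  have xv: "x - a jk = of_real \<delta> * v x jk" for x jk
    using \<delta>(1) by (simp add: a_def v_def split_def field_simps)
  have norm_xv: "norm (x - a jk) = \<delta> * norm (v x jk)" for x jk
    using \<delta>(1) by (simp add: xv norm_mult)
  have finJ: "finite J"
  proof -
    define N where "N = \<lceil>(norm p + 2 * r) / \<delta>\<rceil>"
    have "J \<subseteq> {-N..N} \<times> {-N..N}"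
    proof
      fix jk assume "jk \<in> J"
      then obtain j k where jk: "jk = (j, k)" "a (j, k) \<in> cball p (2 * r)"
        by (cases jk) (auto simp: J_def)
      then have "norm (a (j, k)) \<le> norm p + 2 * r"
        using norm_triangle_ineq2 [of "a (j, k)" p] by (auto simp: dist_norm norm_minus_commute)
      then have 1: "norm (Complex (of_int j) (of_int k)) \<le> (norm p + 2 * r) / \<delta>"
        using \<delta>(1) by (simp add: a_def norm_mult field_simps)
      have "\<bar>of_int j\<bar> \<le> (norm p + 2 * r) / \<delta>" "\<bar>of_int k\<bar> \<le> (norm p + 2 * r) / \<delta>"
        using abs_Re_le_cmod [of "Complex (of_int j) (of_int k)"]
          abs_Im_le_cmod [of "Complex (of_int j) (of_int k)"] 1 by auto
      then have "\<bar>j\<bar> \<le> N" "\<bar>k\<bar> \<le> N"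
        unfolding N_def by (simp_all add: le_ceiling_iff)
      then show "jk \<in> {-N..N} \<times> {-N..N}"
        using jk by auto
    qed
    then show ?thesis
      by (rule finite_subset) auto
  qed
  have lattice: "(\<Sum>jk\<in>J. (norm (v x jk) + (norm (v x jk))\<^sup>2) * exp (- (norm (v x jk))\<^sup>2 / 2)) \<le> C" for x
    using sum_lattice_gaussian [OF finJ, of "x / of_real \<delta>"] by (simp add: C_def v_def split_def)
  have q_est: "norm (q x jk - of_real ((norm (v x jk))\<^sup>2)) \<le> 6 * \<epsilon> * (norm (v x jk))\<^sup>2"
    if x: "x \<in> cball p r" and jk: "jk \<in> J" for x jk
  proof -
    define d where "d = x - a jk"
    define \<rho> where "\<rho> = P x - P (a jk) - of_real (Re d)"
    define \<sigma> where "\<sigma> = Q x - Q (a jk) - of_real (Im d)"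
    have in_ball: "x \<in> cball p (2 * r)" "a jk \<in> cball p (2 * r)"
      using x jk r by (auto simp: J_def)
    have \<rho>: "norm \<rho> \<le> \<epsilon> * norm d" and \<sigma>: "norm \<sigma> \<le> \<epsilon> * norm d"
      unfolding \<rho>_def \<sigma>_def d_def by (intro P_lip Q_lip in_ball)+
    \<comment> \<open>This is the error \<open>(t + z)\<^sup>2 - t\<^sup>2\<close> in one squared
      coordinate.\<close>
    have sq: "norm (2 * of_real t * z + z\<^sup>2) \<le> 3 * \<epsilon> * (norm d)\<^sup>2"
      if "\<bar>t\<bar> \<le> norm d" "norm z \<le> \<epsilon> * norm d" for t and z :: complex
    proof -
      have "norm (2 * of_real t * z + z\<^sup>2) \<le> 2 * \<bar>t\<bar> * norm z + norm z * norm z"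
        by (rule order_trans [OF norm_triangle_ineq]) (simp add: norm_mult power2_eq_square)
      also have "\<dots> \<le> 2 * norm d * (\<epsilon> * norm d) + (\<epsilon> * norm d) * (\<epsilon> * norm d)"
        using that \<epsilon> by (intro add_mono mult_mono) auto
      also have "\<dots> = (2 + \<epsilon>) * (\<epsilon> * (norm d)\<^sup>2)"
        by (simp add: power2_eq_square algebra_simps)
      also have "\<dots> \<le> 3 * (\<epsilon> * (norm d)\<^sup>2)"
        using \<epsilon> by (intro mult_right_mono) auto
      finally show ?thesis by simp
    qed
    have "(of_real \<delta>)\<^sup>2 * q x jk = (of_real (Re d) + \<rho>)\<^sup>2 + (of_real (Im d) + \<sigma>)\<^sup>2"
      using \<delta>(1) by (simp add: q_def \<rho>_def \<sigma>_def)
    also have "\<dots> = of_real ((norm d)\<^sup>2) + ((2 * of_real (Re d) * \<rho> + \<rho>\<^sup>2) + (2 * of_real (Im d) * \<sigma> + \<sigma>\<^sup>2))"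
      by (simp only: cmod_power2 of_real_add of_real_power) (simp add: power2_eq_square algebra_simps)
    finally have "norm ((of_real \<delta>)\<^sup>2 * q x jk - of_real ((norm d)\<^sup>2)) \<le> 3 * \<epsilon> * (norm d)\<^sup>2 + 3 * \<epsilon> * (norm d)\<^sup>2"
      using sq [OF abs_Re_le_cmod \<rho>] sq [OF abs_Im_le_cmod \<sigma>]
      by (simp del: of_real_power) (rule norm_triangle_le, linarith)
    also have "(of_real \<delta>)\<^sup>2 * q x jk - of_real ((norm d)\<^sup>2) = (of_real \<delta>)\<^sup>2 * (q x jk - of_real ((norm (v x jk))\<^sup>2))"
      unfolding d_def norm_xv by (simp add: power_mult_distrib algebra_simps)
    also have "norm \<dots> = \<delta>\<^sup>2 * norm (q x jk - of_real ((norm (v x jk))\<^sup>2))"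
      by (simp add: norm_mult norm_power)
    also have "3 * \<epsilon> * (norm d)\<^sup>2 + 3 * \<epsilon> * (norm d)\<^sup>2 = \<delta>\<^sup>2 * (6 * \<epsilon> * (norm (v x jk))\<^sup>2)"
      unfolding d_def norm_xv by (simp add: power_mult_distrib algebra_simps)
    finally show ?thesis
      using \<delta>(1) by simp
  qed
  define G where "G = (\<lambda>jk x. exp (- q x jk))"
  have GB: "(\<lambda>x. G jk (X x)) \<in> B" for jk
    unfolding G_def q_def by (intro exp uminus divide_const add power diff P Q const)
  have G_norm: "norm (G jk x) \<le> exp (- (norm (v x jk))\<^sup>2 / 2)"
    if x: "x \<in> cball p r" and jk: "jk \<in> J" for x jk
  proof -
    \<comment> \<open>The relative error of the exponent is at most 1/2, so half of the Gaussian
      decay survives; hence the division by 2 in the kernel of \<open>lattice\<close>.\<close>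
    have "6 * \<epsilon> * (norm (v x jk))\<^sup>2 \<le> 1/2 * (norm (v x jk))\<^sup>2"
      using \<epsilon> by (intro mult_right_mono) auto
    then have "\<bar>Re (q x jk - of_real ((norm (v x jk))\<^sup>2))\<bar> \<le> (norm (v x jk))\<^sup>2 / 2"
      using q_est [OF that] abs_Re_le_cmod [of "q x jk - of_real ((norm (v x jk))\<^sup>2)"] by linarith
    then have "Re (q x jk) \<ge> (norm (v x jk))\<^sup>2 / 2"
      unfolding minus_complex.sel Re_complex_of_real by linarith
    then show ?thesis
      by (simp add: G_def)
  qed
  have G_diff: "norm (G jk x - of_real (exp (- (norm (v x jk))\<^sup>2)))
      \<le> 6 * \<epsilon> * ((norm (v x jk) + (norm (v x jk))\<^sup>2) * exp (- (norm (v x jk))\<^sup>2 / 2))"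
    if x: "x \<in> cball p r" and jk: "jk \<in> J" for x jk
  proof -
    let ?s = "(norm (v x jk))\<^sup>2" and ?w = "of_real ((norm (v x jk))\<^sup>2) - q x jk"
    have w: "norm ?w \<le> 6 * \<epsilon> * ?s"
      using q_est [OF that] by (simp add: norm_minus_commute)
    have "6 * \<epsilon> * ?s \<le> 1/2 * ?s"
      using \<epsilon> by (intro mult_right_mono) auto
    then have w': "norm ?w - ?s \<le> - ?s / 2"
      using w by linarith
    have "norm (G jk x - of_real (exp (- ?s))) = norm (exp (?w + of_real (- ?s)) - exp (of_real (- ?s)))"
      by (simp add: G_def flip: exp_of_real)
    also have "\<dots> \<le> norm ?w * exp (norm ?w + (- ?s))"
      by (rule norm_exp_diff_le)
    also have "\<dots> \<le> (6 * \<epsilon> * (norm (v x jk) + ?s)) * exp (- ?s / 2)"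
    proof (rule mult_mono)
      show "norm ?w \<le> 6 * \<epsilon> * (norm (v x jk) + ?s)"
        using w \<epsilon> by (smt (verit) mult_left_mono norm_ge_zero)
    qed (use w' \<epsilon> in auto)
    finally show ?thesis
      by (simp add: mult.assoc)
  qed
  define S1 where "S1 = (\<lambda>x. \<Sum>jk\<in>J. G jk x)"
  define Sh where "Sh = (\<lambda>x. \<Sum>jk\<in>J. h (a jk) * G jk x)"
  have S1B: "(\<lambda>x. S1 (X x)) \<in> B" and ShB: "(\<lambda>x. Sh (X x)) \<in> B"
    unfolding S1_def Sh_def by (intro sum mult const GB)+
  have S1_lower: "Re (S1 x) \<ge> m" if x: "x \<in> cball p r" for x
  proof -
    \<comment> \<open>The lattice point nearest to \<open>x\<close>. Its real Gaussian alone is at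
      least \<open>2 * m\<close>, and passing from all real Gaussians to the complex ones costs at
      most \<open>6 * \<epsilon> * C \<le> m\<close>.\<close>
    define j k where "j = round (Re (x / of_real \<delta>))" and "k = round (Im (x / of_real \<delta>))"
    have "\<bar>Re (v x (j, k))\<bar> \<le> 1/2" "\<bar>Im (v x (j, k))\<bar> \<le> 1/2"
      using of_int_round_abs_le [of "Re (x / of_real \<delta>)"] of_int_round_abs_le [of "Im (x / of_real \<delta>)"]
      by (auto simp: v_def j_def k_def abs_minus_commute)
    then have "(Re (v x (j, k)))\<^sup>2 \<le> (1/2)\<^sup>2" "(Im (v x (j, k)))\<^sup>2 \<le> (1/2)\<^sup>2"
      by (auto simp flip: abs_le_square_iff)
    then have vjk: "(norm (v x (j, k)))\<^sup>2 \<le> 1/2"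
      unfolding cmod_power2 by (simp add: power2_eq_square)
    then have "norm (v x (j, k)) \<le> 1"
      using power2_le_imp_le [of "norm (v x (j, k))" 1] by simp
    then have "norm (x - a (j, k)) \<le> \<delta>"
      using \<delta>(1) by (simp add: norm_xv)
    then have "norm (p - a (j, k)) \<le> 2 * r"
      using x \<delta>(2) norm_triangle_ineq [of "p - x" "x - a (j, k)"] by (simp add: dist_norm)
    then have jkJ: "(j, k) \<in> J"
      by (simp add: J_def dist_norm)
    have "2 * m = exp (-1/2)"
      by (simp add: m_def)
    also have "\<dots> \<le> exp (- (norm (v x (j, k)))\<^sup>2)"
      using vjk by simp
    also have "\<dots> \<le> (\<Sum>jk\<in>J. exp (- (norm (v x jk))\<^sup>2))"
      using jkJ finJ by (intro member_le_sum) auto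
    finally have 1: "2 * m \<le> (\<Sum>jk\<in>J. exp (- (norm (v x jk))\<^sup>2))" .
    have "norm (S1 x - of_real (\<Sum>jk\<in>J. exp (- (norm (v x jk))\<^sup>2)))
        \<le> (\<Sum>jk\<in>J. norm (G jk x - of_real (exp (- (norm (v x jk))\<^sup>2))))"
      unfolding S1_def of_real_sum sum_subtractf [symmetric] by (rule norm_sum)
    also have "\<dots> \<le> (\<Sum>jk\<in>J. 6 * \<epsilon> * ((norm (v x jk) + (norm (v x jk))\<^sup>2) * exp (- (norm (v x jk))\<^sup>2 / 2)))"
      by (intro sum_mono G_diff x)
    also have "\<dots> \<le> 6 * \<epsilon> * C"
      unfolding sum_distrib_left [symmetric] using lattice \<epsilon> by (intro mult_left_mono) auto
    also have "\<dots> \<le> m"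
      by (rule \<epsilon>)
    finally have "\<bar>Re (S1 x - of_real (\<Sum>jk\<in>J. exp (- (norm (v x jk))\<^sup>2)))\<bar> \<le> m"
      using abs_Re_le_cmod order_trans by blast
    then show ?thesis
      using 1 by simp
  qed
  have "(\<lambda>x. 1 / S1 (X x)) \<in> B"
    using S1B Cm(2) by (rule inverse) (use X S1_lower in auto)
  then have "(\<lambda>x. Sh (X x) * (1 / S1 (X x))) \<in> B"
    using ShB by (intro mult)
  moreover have "norm (h x - Sh x * (1 / S1 x)) < e" if x: "x \<in> cball p r" for x
  proof -
    have S1: "norm (S1 x) \<ge> m"
      using S1_lower [OF x] complex_Re_le_cmod order_trans by blast
    \<comment> \<open>The left side is the norm of the sum of
      \<open>(h x - h (a jk)) * G jk x\<close>. The Lipschitz bound contributes a factor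
      \<open>L * \<delta>\<close>, and the remaining sum is bounded independently of the
      mesh.\<close>
    have "norm (h x * S1 x - Sh x) \<le> (\<Sum>jk\<in>J. norm (h x - h (a jk)) * norm (G jk x))"
      unfolding S1_def Sh_def sum_distrib_left sum_subtractf [symmetric]
        left_diff_distrib [symmetric] norm_mult [symmetric] by (rule norm_sum)
    also have "\<dots> \<le> (\<Sum>jk\<in>J. (L * \<delta>) * ((norm (v x jk) + (norm (v x jk))\<^sup>2) * exp (- (norm (v x jk))\<^sup>2 / 2)))"
    proof (rule sum_mono)
      fix jk assume jk: "jk \<in> J"
      have "norm (h x - h (a jk)) \<le> L * \<delta> * norm (v x jk)"
        using h [of x "a jk"] by (simp add: norm_xv)
      also have "\<dots> \<le> L * \<delta> * (norm (v x jk) + (norm (v x jk))\<^sup>2)"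
        using L \<delta> by (intro mult_left_mono) auto
      finally show "norm (h x - h (a jk)) * norm (G jk x)
          \<le> (L * \<delta>) * ((norm (v x jk) + (norm (v x jk))\<^sup>2) * exp (- (norm (v x jk))\<^sup>2 / 2))"
        unfolding mult.assoc [of "L * \<delta>", symmetric]
        using G_norm [OF x jk] L \<delta> by (intro mult_mono) auto
    qed
    also have "\<dots> \<le> L * \<delta> * C"
      unfolding sum_distrib_left [symmetric] using lattice L \<delta> by (intro mult_left_mono) auto
    also have "\<dots> < e * m"
      using \<delta>(3) by (simp add: mult_ac)
    also have "\<dots> \<le> e * norm (S1 x)"
      using S1 e by simp
    finally have "norm (h x * S1 x - Sh x) / norm (S1 x) < e"
      using S1 Cm e by (simp add: divide_less_eq)
    moreover have "h x - Sh x * (1 / S1 x) = (h x * S1 x - Sh x) / S1 x"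
    proof -
      have "S1 x \<noteq> 0"
        using S1 Cm by auto
      then show ?thesis
        by (simp add: field_simps)
    qed
    ultimately show ?thesis
      by (simp add: norm_divide)
  qed
  ultimately show "\<exists>g\<in>B. \<forall>x\<in>K. norm (h (X x) - g x) < e"
    using X by (intro bexI [of _ "\<lambda>x. Sh (X x) * (1 / S1 (X x))"]) auto
qed

text \<open>With both real coordinates of \<open>X\<close> in \<open>B\<close>, all real polynomials
  in them are in \<open>B\<close>, and the Stone-Weierstrass theorem gives every continuous function
  on \<open>S\<close>.\<close>

lemma (in closed_function_algebra) continuous_mem:
  fixes X :: "'b \<Rightarrow> complex"
  assumes S: "compact S" and X: "\<And>x. x \<in> K \<Longrightarrow> X x \<in> S"
    and Re: "(\<lambda>x. of_real (Re (X x))) \<in> B" and Im: "(\<lambda>x. of_real (Im (X x))) \<in> B"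
    and h: "continuous_on S h"
  shows "(\<lambda>x. h (X x)) \<in> B"
proof -
  have poly: "(\<lambda>x. of_real (f (X x))) \<in> B" if "real_polynomial_function f" for f :: "complex \<Rightarrow> real"
    using that
  proof induction
    case (linear f)
    then interpret f: bounded_linear f .
    \<comment> \<open>Here \<open>complex\<close> is a real vector space with basis 1 and
      \<open>\<i>\<close>.\<close>
    have f: "f z = Re z * f 1 + Im z * f \<i>" for z
    proof -
      have "z = Re z *\<^sub>R 1 + Im z *\<^sub>R \<i>"
        by (simp add: complex_eq_iff)
      then show ?thesis
        by (metis f.add f.scaleR real_scaleR_def)
    qed
    have "(\<lambda>x. of_real (Re (X x)) * of_real (f 1) + of_real (Im (X x)) * of_real (f \<i>)) \<in> B"
      using Re Im by (intro add mult const)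
    then show ?case
      by (rule cong) (subst f, simp)
  qed (simp_all add: const add mult)
  show ?thesis
  proof (rule closed)
    fix e :: real assume "e > 0"
    then have "\<exists>g. polynomial_function g \<and> (\<forall>x\<in>S. norm (h x - g x) < e)"
      by (rule Stone_Weierstrass_polynomial_function [OF S h])
    then obtain g where g: "polynomial_function g" "\<And>x. x \<in> S \<Longrightarrow> norm (h x - g x) < e"
      by (elim exE conjE) (rule that, assumption, erule (1) bspec)
    have "real_polynomial_function (\<lambda>z. Re (g z))" "real_polynomial_function (\<lambda>z. Im (g z))"
      using g(1) bounded_linear_Re bounded_linear_Im unfolding polynomial_function_def o_def by blast+
    then have "(\<lambda>x. of_real (Re (g (X x))) + \<i> * of_real (Im (g (X x)))) \<in> B"
      by (intro add mult const poly)
    then have "(\<lambda>x. g (X x)) \<in> B"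
      by (simp flip: complex_eq)
    then show "\<exists>k\<in>B. \<forall>x\<in>K. norm (h (X x) - k x) < e"
      by (intro bexI [of _ "\<lambda>x. g (X x)"] ballI g(2) X)
  qed
qed

section \<open>Families of \<open>C\<^sup>1\<close> functions on a planar domain\<close>

text \<open>The differential is written as \<open>fx dx + fy dy\<close> with complex coefficients.
  Then \<open>df \<and> dg\<close> has coefficient \<open>fx * gy - fy * gx\<close>, and the real
  Jacobian determinant of \<open>f\<close> is \<open>Im (cnj fx * fy)\<close>.\<close>

definition has_C1_partials ::
  "complex set \<Rightarrow> (complex \<Rightarrow> complex) \<Rightarrow> (complex \<Rightarrow> complex) \<Rightarrow> (complex \<Rightarrow> complex) \<Rightarrow> bool" where
  "has_C1_partials D f fx fy \<longleftrightarrow> continuous_on D fx \<and> continuous_on D fy \<and>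
     (\<forall>z\<in>D. (f has_derivative (\<lambda>v. fx z * of_real (Re v) + fy z * of_real (Im v))) (at z))"

lemma has_C1_partialsD:
  assumes "has_C1_partials D f fx fy"
  shows "continuous_on D fx" "continuous_on D fy"
    and "z \<in> D \<Longrightarrow> (f has_derivative (\<lambda>v. fx z * of_real (Re v) + fy z * of_real (Im v))) (at z)"
  using assms by (auto simp: has_C1_partials_def)

lemma has_C1_partials_linear_combination:
  assumes "has_C1_partials D f fx fy" "has_C1_partials D g gx gy"
  shows "has_C1_partials D (\<lambda>z. a * f z + b * g z) (\<lambda>z. a * fx z + b * gx z) (\<lambda>z. a * fy z + b * gy z)"
  unfolding has_C1_partials_def
proof (intro conjI ballI)
  fix z assume z: "z \<in> D"
  show "((\<lambda>z. a * f z + b * g z) has_derivative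
      (\<lambda>v. (a * fx z + b * gx z) * of_real (Re v) + (a * fy z + b * gy z) * of_real (Im v))) (at z)"
    by (rule derivative_eq_intros has_C1_partialsD(3) [OF assms(1) z] has_C1_partialsD(3) [OF assms(2) z] refl)+
       (auto simp: algebra_simps)
qed (intro continuous_intros has_C1_partialsD(1,2) [OF assms(1)] has_C1_partialsD(1,2) [OF assms(2)])+

lemma bounded_linear_partials: "bounded_linear (\<lambda>v. a * complex_of_real (Re v) + b * of_real (Im v))"
  by (intro bounded_linear_intros bounded_linear_compose [OF bounded_linear_of_real]
      bounded_linear_Re bounded_linear_Im)

text \<open>The mean value inequality, applied to \<open>f\<close> minus its linear part at
  \<open>p\<close>: on a small disc each partial derivative of the difference is below
  \<open>\<epsilon> / 2\<close>.\<close>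

lemma has_C1_partials_approx_linear:
  assumes f: "has_C1_partials D f fx fy" and "open D" "p \<in> D" and e: "\<epsilon> > 0"
  obtains r where "r > 0" "cball p r \<subseteq> D"
    "\<And>x y. \<lbrakk>x \<in> cball p r; y \<in> cball p r\<rbrakk> \<Longrightarrow>
       norm (f x - f y - (fx p * of_real (Re (x - y)) + fy p * of_real (Im (x - y)))) \<le> \<epsilon> * norm (x - y)"
proof -
  have near: "\<forall>\<^sub>F z in nhds p. dist (k z) (k p) < \<epsilon> / 2" if "continuous_on D k" for k :: "complex \<Rightarrow> complex"
  proof -
    have "k \<midarrow>p\<rightarrow> k p"
      using that assms(2,3) by (auto simp: continuous_on_eq_continuous_at isCont_def)
    from tendstoD [OF this half_gt_zero [OF e]] show ?thesis
      using e by (simp add: eventually_nhds_conv_at)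
  qed
  have "\<forall>\<^sub>F z in nhds p. z \<in> D"
    using assms by (intro eventually_nhds_in_open)
  moreover have "\<forall>\<^sub>F z in nhds p. dist (fx z) (fx p) < \<epsilon> / 2" "\<forall>\<^sub>F z in nhds p. dist (fy z) (fy p) < \<epsilon> / 2"
    using near has_C1_partialsD(1,2) [OF f] by blast+
  ultimately have "\<forall>\<^sub>F z in nhds p. z \<in> D \<and> dist (fx z) (fx p) < \<epsilon> / 2 \<and> dist (fy z) (fy p) < \<epsilon> / 2"
    by eventually_elim auto
  then obtain d where d: "d > 0"
    "\<And>z. dist z p < d \<Longrightarrow> z \<in> D \<and> dist (fx z) (fx p) < \<epsilon> / 2 \<and> dist (fy z) (fy p) < \<epsilon> / 2"
    unfolding eventually_nhds_metric by auto
  define r where "r = d / 2"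
  have r: "z \<in> D" "dist (fx z) (fx p) < \<epsilon> / 2" "dist (fy z) (fy p) < \<epsilon> / 2" if "z \<in> cball p r" for z
    using d(2) [of z] d(1) that by (auto simp: r_def dist_commute)
  let ?g = "\<lambda>z. f z - (fx p * of_real (Re z) + fy p * of_real (Im z))"
  let ?g' = "\<lambda>z v. (fx z - fx p) * of_real (Re v) + (fy z - fy p) * of_real (Im v)"
  have "norm (?g x - ?g y) \<le> \<epsilon> * norm (x - y)" if "x \<in> cball p r" "y \<in> cball p r" for x y
  proof (rule differentiable_bound)
    fix z assume z: "z \<in> cball p r"
    have "(?g has_derivative ?g' z) (at z)"
      by (rule derivative_eq_intros has_C1_partialsD(3) [OF f r(1) [OF z]]
          bounded_linear_imp_has_derivative [OF bounded_linear_partials])+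
         (auto simp: algebra_simps)
    then show "(?g has_derivative ?g' z) (at z within cball p r)"
      by (rule has_derivative_at_withinI)
    show "onorm (?g' z) \<le> \<epsilon>"
    proof (rule onorm_bound)
      fix v
      have "norm (?g' z v) \<le> norm (fx z - fx p) * \<bar>Re v\<bar> + norm (fy z - fy p) * \<bar>Im v\<bar>"
        by (rule order_trans [OF norm_triangle_ineq]) (simp add: norm_mult)
      also have "\<dots> \<le> \<epsilon> / 2 * norm v + \<epsilon> / 2 * norm v"
        using r [OF z] e abs_Re_le_cmod abs_Im_le_cmod by (intro add_mono mult_mono) (auto simp: dist_norm)
      finally show "norm (?g' z v) \<le> \<epsilon> * norm v"
        by simp
    qed (use e in auto)
  qed (use that in auto)
  then show ?thesis
    using d(1) r by (intro that [of r]) (auto simp: r_def algebra_simps)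
qed

section \<open>Local coordinates and proportional differentials\<close>

text \<open>The inverse function theorem in terms of the partials. The last conclusion says that
  \<open>g' w\<close> is a right inverse of the differential of \<open>f\<close> at
  \<open>g w\<close>.\<close>

lemma has_C1_partials_local_inverse:
  assumes f: "has_C1_partials D f fx fy" and "open D" "p \<in> D" and J: "Im (cnj (fx p) * fy p) \<noteq> 0"
  obtains V \<Omega> g g' where "open V" "V \<subseteq> D" "p \<in> V" "open \<Omega>" "f p \<in> \<Omega>" "homeomorphism V \<Omega> f g"
    "\<And>w. w \<in> \<Omega> \<Longrightarrow> (g has_derivative g' w) (at w)"
    "\<And>w v. w \<in> \<Omega> \<Longrightarrow> fx (g w) * of_real (Re (g' w v)) + fy (g w) * of_real (Im (g' w v)) = v"
proof -
  define f' where "f' = (\<lambda>z. Blinfun (\<lambda>v. fx z * complex_of_real (Re v) + fy z * of_real (Im v)))"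
  have f': "blinfun_apply (f' z) = (\<lambda>v. fx z * of_real (Re v) + fy z * of_real (Im v))" for z
    unfolding f'_def by (rule bounded_linear_Blinfun_apply [OF bounded_linear_partials])
  \<comment> \<open>Cramer's rule for solving \<open>fx p * s + fy p * t = w\<close> in real
    \<open>s\<close> and \<open>t\<close>.\<close>
  define invf where "invf = Blinfun (\<lambda>w. complex_of_real (- Im (cnj (fy p) * w) / Im (cnj (fx p) * fy p)) +
                                    \<i> * of_real (Im (cnj (fx p) * w) / Im (cnj (fx p) * fy p)))"
  have invf: "blinfun_apply invf = (\<lambda>w. complex_of_real (- Im (cnj (fy p) * w) / Im (cnj (fx p) * fy p)) +
                                    \<i> * of_real (Im (cnj (fx p) * w) / Im (cnj (fx p) * fy p)))"
    unfolding invf_def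
    by (intro bounded_linear_Blinfun_apply bounded_linear_add bounded_linear_compose [OF bounded_linear_of_real]
        bounded_linear_compose [OF bounded_linear_mult_right] bounded_linear_compose [OF bounded_linear_divide]
        bounded_linear_minus bounded_linear_compose [OF bounded_linear_Im bounded_linear_mult_right])
  have "continuous_on D f'"
    by (rule continuous_on_blinfun_componentwise)
       (use has_C1_partialsD(1,2) [OF f] in \<open>auto simp: f' Basis_complex_def\<close>)
  moreover have "(f has_derivative blinfun_apply (f' z)) (at z)" if "z \<in> D" for z
    unfolding f' using f that by (rule has_C1_partialsD)
  moreover have "invf o\<^sub>L f' p = id_blinfun"
  proof (rule blinfun_eqI)
    fix v :: complex
    have "Im (cnj (fy p) * (fx p * of_real (Re v) + fy p * of_real (Im v))) = - Re v * Im (cnj (fx p) * fy p)"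
      "Im (cnj (fx p) * (fx p * of_real (Re v) + fy p * of_real (Im v))) = Im v * Im (cnj (fx p) * fy p)"
      by (simp_all add: algebra_simps)
    then have "invf (f' p v) = complex_of_real (Re v) + \<i> * of_real (Im v)"
      unfolding invf f' using J by simp
    then show "(invf o\<^sub>L f' p) v = id_blinfun v"
      by (simp flip: complex_eq)
  qed
  ultimately obtain V \<Omega> g g' where *: "open V" "V \<subseteq> D" "p \<in> V" "open \<Omega>" "f p \<in> \<Omega>" "homeomorphism V \<Omega> f g"
    "\<And>w. w \<in> \<Omega> \<Longrightarrow> (g has_derivative g' w) (at w)"
    "\<And>w. w \<in> \<Omega> \<Longrightarrow> g' w = inv (blinfun_apply (f' (g w)))"
    "\<And>w. w \<in> \<Omega> \<Longrightarrow> bij (blinfun_apply (f' (g w)))"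
    using inverse_function_theorem [OF \<open>open D\<close> _ _ \<open>p \<in> D\<close>] by (metis (no_types, lifting))
  have "f' (g w) (g' w v) = v" if "w \<in> \<Omega>" for w v
    using *(8,9) [OF that] by (simp add: bij_is_surj surj_f_inv_f)
  with * show ?thesis
    by (intro that [of V \<Omega> g g']) (auto simp: f')
qed

lemma has_C1_partials_compose:
  assumes g: "has_C1_partials D g gx gy" and "h w \<in> D" "(h has_derivative h') (at w)"
  shows "((\<lambda>w. g (h w)) has_derivative (\<lambda>v. gx (h w) * of_real (Re (h' v)) + gy (h w) * of_real (Im (h' v)))) (at w)"
  using has_derivative_compose [OF assms(3) has_C1_partialsD(3) [OF g assms(2)]] .

text \<open>The vanishing wedge makes the differential of \<open>g\<close> a complex multiple
  \<open>c\<close> of that of the coordinate \<open>f\<close>. As \<open>h'\<close> inverts the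
  latter, \<open>g\<close> composed with \<open>h\<close> has the complex-linear differential
  \<open>c * v\<close>.\<close>

lemma holomorphic_in_proportional_coordinate:
  assumes g: "has_C1_partials D g gx gy" and "h w \<in> D" "(h has_derivative h') (at w)"
    and h': "\<And>v. fx (h w) * of_real (Re (h' v)) + fy (h w) * of_real (Im (h' v)) = v"
    and wedge: "fx (h w) * gy (h w) = fy (h w) * gx (h w)"
  shows "\<exists>c. ((\<lambda>w. g (h w)) has_field_derivative c) (at w)"
proof -
  have "\<exists>c. gx (h w) = c * fx (h w) \<and> gy (h w) = c * fy (h w)"
  proof (cases "fx (h w) = 0")
    case True
    then have "fy (h w) \<noteq> 0"
      using h' [of 1] by auto
    then show ?thesis
      using True wedge by (intro exI [of _ "gy (h w) / fy (h w)"]) auto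
  next
    case False
    then show ?thesis
      using wedge by (intro exI [of _ "gx (h w) / fx (h w)"]) (auto simp: field_simps)
  qed
  then obtain c where c: "gx (h w) = c * fx (h w)" "gy (h w) = c * fy (h w)"
    by blast
  have "(\<lambda>v. gx (h w) * of_real (Re (h' v)) + gy (h w) * of_real (Im (h' v))) = (*) c"
  proof
    fix v
    have "gx (h w) * of_real (Re (h' v)) + gy (h w) * of_real (Im (h' v)) =
        c * (fx (h w) * of_real (Re (h' v)) + fy (h w) * of_real (Im (h' v)))"
      by (simp add: c algebra_simps)
    then show "gx (h w) * of_real (Re (h' v)) + gy (h w) * of_real (Im (h' v)) = c * v"
      by (simp only: h')
  qed
  then show ?thesis
    using has_C1_partials_compose [OF assms(1-3)] by (auto simp: has_field_derivative_def)
qed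

text \<open>A vanishing Jacobian puts the values of the differential \<open>(a, b)\<close> on one
  real line, on which the real part of multiplication by \<open>c\<close> is injective by
  \<open>nz\<close>. A vector killed by that real part is thus killed by \<open>(a, b)\<close>, and
  then by the proportional \<open>(a', b')\<close>.\<close>

lemma rank_one_common_kernel:
  fixes a b a' b' c :: complex and s t :: real
  assumes rank: "Im (cnj a * b) = 0" and wedge: "a * b' = b * a'"
    and nz: "Re (c * a) \<noteq> 0 \<or> Re (c * b) \<noteq> 0" and st: "Re (c * a) * s + Re (c * b) * t = 0"
  shows "a' * of_real s + b' * of_real t = 0"
proof -
  \<comment> \<open>The kernel of a nonzero real functional on the plane is spanned by its
    coefficient vector turned by a right angle.\<close>
  have "\<exists>k. s = - k * Re (c * b) \<and> t = k * Re (c * a)"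
  proof (cases "Re (c * a) = 0")
    case True
    then show ?thesis
      using nz st by (intro exI [of _ "- s / Re (c * b)"]) auto
  next
    case False
    then show ?thesis
      using st by (intro exI [of _ "t / Re (c * a)"]) (auto simp: field_simps)
  qed
  then obtain k where k: "s = - k * Re (c * b)" "t = k * Re (c * a)"
    by blast
  have "Im (cnj (c * a) * (c * b)) = Re (c * cnj c) * Im (cnj a * b)"
    by (simp add: algebra_simps)
  moreover have "Im (cnj z * w) = Re z * Im w - Im z * Re w" for z w
    by simp
  ultimately have rank': "Re (c * a) * Im (c * b) - Im (c * a) * Re (c * b) = 0"
    using rank by (metis mult_zero_right)
  have "c * (a * of_real s + b * of_real t) = (c * a) * of_real s + (c * b) * of_real t"
    by (simp add: algebra_simps)
  also have "\<dots> = 0"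
  proof (rule complex_eqI)
    show "Re ((c * a) * of_real s + (c * b) * of_real t) = Re 0"
      unfolding plus_complex.sel times_complex.sel(1) [of "c * a" "of_real s"]
        times_complex.sel(1) [of "c * b" "of_real t"] using st by simp
    have "Im ((c * a) * of_real s + (c * b) * of_real t) = Im (c * a) * s + Im (c * b) * t"
      unfolding plus_complex.sel times_complex.sel(2) [of "c * a" "of_real s"]
        times_complex.sel(2) [of "c * b" "of_real t"] by simp
    also have "\<dots> = k * (Re (c * a) * Im (c * b) - Im (c * a) * Re (c * b))"
      unfolding k by (simp only: algebra_simps)
    finally show "Im ((c * a) * of_real s + (c * b) * of_real t) = Im 0"
      using rank' by simp
  qed
  finally have 0: "a * of_real s + b * of_real t = 0"
    using nz by auto
  show ?thesis
  proof (cases "a = 0")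
    case True
    then have "b \<noteq> 0" "t = 0" "a' = 0"
      using nz 0 wedge by auto
    then show ?thesis by simp
  next
    case False
    have "a * (a' * of_real s + b' * of_real t) = a' * (a * of_real s + b * of_real t)"
      using wedge by (simp add: algebra_simps)
    then show ?thesis
      using 0 False by simp
  qed
qed

text \<open>If all differentials vanish, every member is constant on a disc. Otherwise some
  \<open>u = Re (c * \<phi> f)\<close> has nonzero gradient at a point, and every member is constant
  along the level curve of \<open>u\<close> there.\<close>

lemma rank_one_family_not_separating:
  fixes \<phi> :: "'i \<Rightarrow> complex \<Rightarrow> complex"
  assumes "open D" "p \<in> D" and G: "\<And>g. g \<in> G \<Longrightarrow> has_C1_partials D (\<phi> g) (gx g) (gy g)"
    and wedge: "\<And>f g z. \<lbrakk>f \<in> G; g \<in> G; z \<in> D\<rbrakk> \<Longrightarrow> gx f z * gy g z = gy f z * gx g z"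
    and rank: "\<And>f z. \<lbrakk>f \<in> G; z \<in> D\<rbrakk> \<Longrightarrow> Im (cnj (gx f z) * gy f z) = 0"
  shows "\<exists>x\<in>D. \<exists>y\<in>D. x \<noteq> y \<and> (\<forall>g\<in>G. \<phi> g x = \<phi> g y)"
proof (cases "\<forall>g\<in>G. \<forall>z\<in>D. gx g z = 0 \<and> gy g z = 0")
  case True
  obtain r where r: "r > 0" "cball p r \<subseteq> D"
    using assms(1,2) open_contains_cball by blast
  have "\<phi> g p = \<phi> g (p + of_real r)" if g: "g \<in> G" for g
  proof (rule has_derivative_zero_unique [of "cball p r" "\<phi> g"])
    fix z assume "z \<in> cball p r"
    then have "z \<in> D" using r by auto
    then show "(\<phi> g has_derivative (\<lambda>h. 0)) (at z within cball p r)"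
      using has_C1_partialsD(3) [OF G [OF g]] True g by (auto intro: has_derivative_at_withinI)
  qed (use r in \<open>auto simp: dist_norm\<close>)
  moreover have "p + of_real r \<in> D"
    using r by (auto simp: dist_norm subset_iff)
  ultimately show ?thesis
    using r assms(2) by (intro bexI [of _ p] bexI [of _ "p + of_real r"]) auto
next
  case False
  then obtain f q where f: "f \<in> G" and q: "q \<in> D" and nz: "gx f q \<noteq> 0 \<or> gy f q \<noteq> 0"
    by blast
  \<comment> \<open>Makes \<open>c\<close> times a nonvanishing partial of \<open>f\<close> at
    \<open>q\<close> its squared modulus, so that the gradient of \<open>u\<close> is nonzero at
    \<open>q\<close>.\<close>
  define c where "c = (if gx f q \<noteq> 0 then cnj (gx f q) else cnj (gy f q))"
  define ux where "ux = (\<lambda>z. Re (c * gx f z))"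
  define uy where "uy = (\<lambda>z. Re (c * gy f z))"
  have u_nz: "ux q \<noteq> 0 \<or> uy q \<noteq> 0"
    using nz complex_norm_square [of "gx f q"] complex_norm_square [of "gy f q"]
    by (auto simp: ux_def uy_def c_def mult.commute complex_norm_square [symmetric]
        simp del: times_complex.sel of_real_power)
  \<comment> \<open>Completes \<open>u\<close> to local coordinates: the imaginary part is linear,
    with gradient that of \<open>u\<close> at \<open>q\<close> turned by a right angle. The Jacobian
    at \<open>q\<close> is then the squared length of that gradient.\<close>
  define \<Phi> where "\<Phi> = (\<lambda>z. complex_of_real (Re (c * \<phi> f z)) + \<i> * of_real (ux q * Im z - uy q * Re z))"
  define \<Phi>x where "\<Phi>x = (\<lambda>z. complex_of_real (ux z) - \<i> * of_real (uy q))"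
  define \<Phi>y where "\<Phi>y = (\<lambda>z. complex_of_real (uy z) + \<i> * of_real (ux q))"
  have \<Phi>: "has_C1_partials D \<Phi> \<Phi>x \<Phi>y"
    unfolding has_C1_partials_def
  proof (intro conjI ballI)
    show "continuous_on D \<Phi>x" "continuous_on D \<Phi>y"
      unfolding \<Phi>x_def \<Phi>y_def ux_def uy_def
      by (intro continuous_intros has_C1_partialsD(1,2) [OF G [OF f]])+
    fix z assume z: "z \<in> D"
    note [derivative_intros] = bounded_linear.has_derivative [OF bounded_linear_Re]
      bounded_linear.has_derivative [OF bounded_linear_Im] bounded_linear.has_derivative [OF bounded_linear_of_real]
    show "(\<Phi> has_derivative (\<lambda>v. \<Phi>x z * of_real (Re v) + \<Phi>y z * of_real (Im v))) (at z)"
      unfolding \<Phi>_def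
      by (rule derivative_eq_intros has_C1_partialsD(3) [OF G [OF f] z] refl)+
         (auto simp: \<Phi>x_def \<Phi>y_def ux_def uy_def complex_eq_iff algebra_simps)
  qed
  have "Im (cnj (\<Phi>x q) * \<Phi>y q) = (ux q)\<^sup>2 + (uy q)\<^sup>2"
    by (simp add: \<Phi>x_def \<Phi>y_def power2_eq_square)
  also have "\<dots> \<noteq> 0"
    using u_nz by (simp add: sum_power2_eq_zero_iff)
  finally obtain V \<Omega> h h' where V: "open V" "V \<subseteq> D" "q \<in> V" "open \<Omega>" "\<Phi> q \<in> \<Omega>" "homeomorphism V \<Omega> \<Phi> h"
    and h: "\<And>w. w \<in> \<Omega> \<Longrightarrow> (h has_derivative h' w) (at w)"
    and h': "\<And>w v. w \<in> \<Omega> \<Longrightarrow> \<Phi>x (h w) * of_real (Re (h' w v)) + \<Phi>y (h w) * of_real (Im (h' w v)) = v"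
    by (rule has_C1_partials_local_inverse [OF \<Phi> assms(1) q]) (rule that; assumption)
  have hV: "h w \<in> V" if "w \<in> \<Omega>" for w
    using V(6) that by (auto simp: homeomorphism_def)
  obtain r where r: "r > 0" "cball (\<Phi> q) r \<subseteq> \<Omega>"
    using V open_contains_cball by blast
  \<comment> \<open>On this vertical segment the real coordinate \<open>u\<close> is fixed, so
    \<open>h\<close> maps it to an arc of a level curve.\<close>
  define w where "w = (\<lambda>t::real. \<Phi> q + \<i> * of_real t)"
  have w: "w t \<in> \<Omega>" if "t \<in> {0..r}" for t
    using that r by (auto simp: w_def dist_norm norm_mult subset_iff)
  have "\<phi> g (h (w 0)) = \<phi> g (h (w r))" if g: "g \<in> G" for g
  proof (rule has_derivative_zero_unique [of "{0..r}" "\<lambda>t. \<phi> g (h (w t))"])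
    fix t assume t: "t \<in> {0..r}"
    let ?z = "h (w t)"
    have z: "?z \<in> D"
      using hV [OF w [OF t]] V by auto
    have u': "ux ?z * Re (h' (w t) v) + uy ?z * Im (h' (w t) v) = Re v" for v
      using arg_cong [OF h' [OF w [OF t], of v], of Re] by (simp add: \<Phi>x_def \<Phi>y_def)
    have w': "(w has_derivative (\<lambda>s. \<i> * of_real s)) (at t within {0..r})"
      unfolding w_def by (auto intro!: derivative_eq_intros bounded_linear.has_derivative [OF bounded_linear_of_real])
    have "((\<lambda>t. \<phi> g (h (w t))) has_derivative
        (\<lambda>s. gx g ?z * of_real (Re (h' (w t) (\<i> * of_real s))) + gy g ?z * of_real (Im (h' (w t) (\<i> * of_real s)))))
        (at t within {0..r})"
      using has_derivative_compose [OF w' has_C1_partials_compose [OF G [OF g] z h [OF w [OF t]]]] .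
    moreover have "gx g ?z * of_real (Re (h' (w t) (\<i> * of_real s))) + gy g ?z * of_real (Im (h' (w t) (\<i> * of_real s))) = 0" for s
    proof (rule rank_one_common_kernel [OF rank [OF f z] wedge [OF f g z]])
      show "Re (c * gx f ?z) \<noteq> 0 \<or> Re (c * gy f ?z) \<noteq> 0"
        using u' [of 1] unfolding ux_def uy_def by (metis add_0 mult_zero_left one_complex.sel(1) zero_neq_one)
      show "Re (c * gx f ?z) * Re (h' (w t) (\<i> * of_real s)) + Re (c * gy f ?z) * Im (h' (w t) (\<i> * of_real s)) = 0"
        using u' [of "\<i> * of_real s"] by (simp add: ux_def uy_def)
    qed
    ultimately show "((\<lambda>t. \<phi> g (h (w t))) has_derivative (\<lambda>s. 0)) (at t within {0..r})"
      by simp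
  qed (use r in auto)
  moreover have "h (w 0) \<noteq> h (w r)"
  proof
    assume "h (w 0) = h (w r)"
    then have "w 0 = w r"
      using V(6) w [of 0] w [of r] r by (metis atLeastAtMost_iff homeomorphism_apply2 less_eq_real_def order_refl)
    then show False
      using r by (simp add: w_def)
  qed
  moreover have "h (w 0) \<in> D" "h (w r) \<in> D"
    using hV w V r by auto
  ultimately show ?thesis
    by blast
qed

section \<open>Regular uniform algebras near a planar piece of the space\<close>

lemma mtopology_closure_of_C_space:
  assumes "topspace X \<noteq> {}" and S: "S \<subseteq> mspace (C_space X)"
  shows "mtopology_of (C_space X) closure_of S =
           {f \<in> mspace (C_space X). \<forall>e>0. \<exists>g\<in>S. \<forall>x\<in>topspace X. norm (f x - g x) < e}"
proof -
  interpret Metric_space "mspace (C_space X)" "mdist (C_space X)"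
    by (rule Metric_space_mspace_mdist)
  have le: "mdist (C_space X) f g \<le> a \<longleftrightarrow> (\<forall>x\<in>topspace X. norm (f x - g x) \<le> a)"
    if "f \<in> mspace (C_space X)" "g \<in> mspace (C_space X)" for f g a
    using cfunspace_mdist_le [OF that assms(1)] by (simp add: dist_norm)
  have "(\<forall>r>0. \<exists>g\<in>S. g \<in> mball f r) \<longleftrightarrow> (\<forall>e>0. \<exists>g\<in>S. \<forall>x\<in>topspace X. norm (f x - g x) < e)"
    if f: "f \<in> mspace (C_space X)" for f
  proof (intro iffI allI impI)
    fix e :: real assume "\<forall>r>0. \<exists>g\<in>S. g \<in> mball f r" "e > 0"
    then obtain g where g: "g \<in> S" "g \<in> mball f (e / 2)"
      using half_gt_zero by blast
    then have "\<forall>x\<in>topspace X. norm (f x - g x) \<le> e / 2"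
      using le [OF f] S by (metis in_mball less_eq_real_def)
    then show "\<exists>g\<in>S. \<forall>x\<in>topspace X. norm (f x - g x) < e"
      using g \<open>e > 0\<close> by (intro bexI [of _ g]) fastforce+
  next
    fix r :: real assume "\<forall>e>0. \<exists>g\<in>S. \<forall>x\<in>topspace X. norm (f x - g x) < e" "r > 0"
    \<comment> \<open>A strict pointwise bound gives only a non-strict bound on the supremum, hence
      the halved radius.\<close>
    then obtain g where g: "g \<in> S" "\<forall>x\<in>topspace X. norm (f x - g x) < r / 2"
      using half_gt_zero by blast
    then have "mdist (C_space X) f g \<le> r / 2"
      using le [OF f] S by (meson less_eq_real_def subsetD)
    then show "\<exists>g\<in>S. g \<in> mball f r"
      using g \<open>r > 0\<close> f S by (intro bexI [of _ g]) (auto simp del: mspace_cfunspace)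
  qed
  then show ?thesis
    unfolding mtopology_of_def metric_closure_of by blast
qed

lemma uniform_algebra_topspace_nonempty: "uniform_algebra X A \<Longrightarrow> topspace X \<noteq> {}"
  and uniform_algebra_compact_space: "uniform_algebra X A \<Longrightarrow> compact_space X"
  and uniform_algebra_subset: "uniform_algebra X A \<Longrightarrow> A \<subseteq> mspace (C_space X)"
  by (simp_all add: uniform_algebra_def compact_Hausdorff_def subalgebra_of_C_def)

lemma uniform_algebra_continuous_map: "\<lbrakk>uniform_algebra X A; f \<in> A\<rbrakk> \<Longrightarrow> continuous_map X euclidean f"
  using uniform_algebra_subset uniform_algebra_compact_space mspace_C_space by blast

lemma uniform_algebra_bounded:
  assumes "uniform_algebra X A" "f \<in> A"
  obtains b where "b > 0" "\<And>x. x \<in> topspace X \<Longrightarrow> norm (f x) \<le> b"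
proof -
  have "compact (f ` topspace X)"
    using image_compactin [OF _ uniform_algebra_continuous_map [OF assms]] uniform_algebra_compact_space [OF assms(1)]
    by (simp add: compact_space_def)
  then show ?thesis
    using compact_imp_bounded bounded_pos that by (metis imageI)
qed

lemma uniform_algebra_closed:
  assumes A: "uniform_algebra X A" and f: "f \<in> mspace (C_space X)"
    and approx: "\<And>e. e > 0 \<Longrightarrow> \<exists>g\<in>A. \<forall>x\<in>topspace X. norm (f x - g x) < e"
  shows "f \<in> A"
proof -
  have "f \<in> mtopology_of (C_space X) closure_of A"
    unfolding mtopology_closure_of_C_space [OF uniform_algebra_topspace_nonempty uniform_algebra_subset, OF A A]
    using f approx by blast
  moreover have "closedin (mtopology_of (C_space X)) A"
    using A by (simp add: uniform_algebra_def)
  ultimately show ?thesis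
    by (simp add: closure_of_closedin)
qed

lemma generates_approx:
  assumes A: "uniform_algebra X A" and "generates X F A" "f \<in> A" "e > 0"
  obtains g where "g \<in> polynomials_in X F" "\<And>x. x \<in> topspace X \<Longrightarrow> norm (f x - g x) < e"
proof -
  have "polynomials_in X F \<subseteq> mspace (C_space X)" "f \<in> mtopology_of (C_space X) closure_of (polynomials_in X F)"
    using assms uniform_algebra_subset [OF A] by (auto simp: generates_def simp del: mspace_cfunspace)
  then have "\<forall>e>0. \<exists>g\<in>polynomials_in X F. \<forall>x\<in>topspace X. norm (f x - g x) < e"
    using mtopology_closure_of_C_space [OF uniform_algebra_topspace_nonempty [OF A], of "polynomials_in X F"]
    by (simp del: mspace_cfunspace)
  then show ?thesis
    using that \<open>e > 0\<close> by meson
qed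

text \<open>\<open>\<psi>\<close> parametrises an open piece of \<open>M\<close> by a planar domain,
  as the inverse of a chart does. Its openness makes complements of images of open sets closed, so
  that regularity yields bump functions.\<close>

locale regular_algebra_on_planar_piece =
  fixes M :: "'a topology" and A :: "('a \<Rightarrow> complex) set" and D :: "complex set" and \<psi> :: "complex \<Rightarrow> 'a"
  assumes alg: "uniform_algebra M A" and regular: "regular_on M A"
    and open_D: "open D" and \<psi>_cont: "continuous_map (top_of_set D) M \<psi>" and \<psi>_inj: "inj_on \<psi> D"
    and \<psi>_open: "\<lbrakk>open V; V \<subseteq> D\<rbrakk> \<Longrightarrow> openin M (\<psi> ` V)"
begin

lemma \<psi>_topspace: "z \<in> D \<Longrightarrow> \<psi> z \<in> topspace M"
  using \<psi>_cont by (auto simp: continuous_map_def)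

lemma continuous_on_pullback:
  assumes "continuous_map M euclidean f"
  shows "continuous_on D (\<lambda>z. f (\<psi> z))"
  using continuous_map_compose [OF \<psi>_cont assms] by (simp add: o_def)

lemma bump:
  assumes "open V" "V \<subseteq> D" "p \<in> V"
  obtains a where "a \<in> A" "a (\<psi> p) = 1" "\<And>x. \<lbrakk>x \<in> topspace M; x \<notin> \<psi> ` V\<rbrakk> \<Longrightarrow> a x = 0"
proof -
  have "closedin M (topspace M - \<psi> ` V)"
    using \<psi>_open assms by blast
  moreover have "\<psi> p \<in> topspace M - (topspace M - \<psi> ` V)"
    using assms \<psi>_topspace by blast
  ultimately obtain a where "a \<in> A" "a (\<psi> p) = 1" "a ` (topspace M - \<psi> ` V) \<subseteq> {0}"
    using regular unfolding regular_on_def by meson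
  then show ?thesis
    by (intro that [of a]) auto
qed

text \<open>The uniform closure on \<open>K\<close> of the pullbacks of \<open>A\<close>, with
  values off \<open>K\<close> left arbitrary to fit \<open>closed_function_algebra\<close>.\<close>

definition local_closure :: "complex set \<Rightarrow> (complex \<Rightarrow> complex) set" where
  "local_closure K = {h. \<forall>e>0. \<exists>a\<in>A. \<forall>z\<in>K. norm (h z - a (\<psi> z)) < e}"

lemma local_closureI: "a \<in> A \<Longrightarrow> (\<lambda>z. a (\<psi> z)) \<in> local_closure K"
  unfolding local_closure_def by (intro CollectI allI impI bexI [of _ a]) auto

lemma closed_function_algebra_local_closure:
  assumes "K \<subseteq> D"
  shows "closed_function_algebra K (local_closure K)"
proof
  have K: "\<psi> z \<in> topspace M" if "z \<in> K" for z
    using that assms \<psi>_topspace by blast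
  have bdd: "\<exists>b. \<forall>z\<in>K. norm (f z) \<le> b" if f: "f \<in> local_closure K" for f
  proof -
    obtain a where a: "a \<in> A" "\<forall>z\<in>K. norm (f z - a (\<psi> z)) < 1"
      using f zero_less_one unfolding local_closure_def by blast
    obtain b where b: "\<And>x. x \<in> topspace M \<Longrightarrow> norm (a x) \<le> b"
      using uniform_algebra_bounded [OF alg a(1)] by blast
    have "norm (f z) \<le> b + 1" if "z \<in> K" for z
      using a(2) b [OF K [OF that]] norm_triangle_ineq2 [of "f z" "a (\<psi> z)"] that by fastforce
    then show ?thesis by blast
  qed
  then show "\<exists>b. \<forall>z\<in>K. norm (f z) \<le> b" if "f \<in> local_closure K" for f
    using that .
  have "const_on M c \<in> A" for c
    using alg by (simp add: uniform_algebra_def)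
  then show "(\<lambda>_. c) \<in> local_closure K" for c
    unfolding local_closure_def
    by (intro CollectI allI impI bexI [of _ "const_on M c"]) (simp_all add: const_on_def K)
  show "(\<lambda>z. f z + g z) \<in> local_closure K" if f: "f \<in> local_closure K" and g: "g \<in> local_closure K" for f g
    unfolding local_closure_def
  proof (intro CollectI allI impI)
    fix e :: real assume "e > 0"
    then have e2: "e / 2 > 0" by simp
    obtain a where a: "a \<in> A" "\<forall>z\<in>K. norm (f z - a (\<psi> z)) < e / 2"
      using f e2 unfolding local_closure_def by blast
    obtain b where b: "b \<in> A" "\<forall>z\<in>K. norm (g z - b (\<psi> z)) < e / 2"
      using g e2 unfolding local_closure_def by blast
    have "add_on M a b \<in> A"
      using a b alg by (simp add: uniform_algebra_def subalgebra_of_C_def)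
    moreover have "norm (f z + g z - add_on M a b (\<psi> z)) < e" if "z \<in> K" for z
      using norm_diff_triangle_ineq [of "f z" "g z" "a (\<psi> z)" "b (\<psi> z)"] a b that K [OF that]
      by (fastforce simp: add_on_def)
    ultimately show "\<exists>a\<in>A. \<forall>z\<in>K. norm (f z + g z - a (\<psi> z)) < e"
      by blast
  qed
  show "(\<lambda>z. f z * g z) \<in> local_closure K" if f: "f \<in> local_closure K" and g: "g \<in> local_closure K" for f g
    unfolding local_closure_def
  proof (intro CollectI allI impI)
    fix e :: real assume e: "e > 0"
    obtain C where C: "\<forall>z\<in>K. norm (f z) \<le> C"
      using bdd [OF f] by blast
    have e': "e / (2 * (\<bar>C\<bar> + 1)) > 0"
      using e by simp
    \<comment> \<open>The order matters: \<open>g\<close> is approximated relative to the bound of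
      \<open>f\<close>, and only then \<open>f\<close> relative to the bound of the approximant
      \<open>b\<close>.\<close>
    obtain b where b: "b \<in> A" "\<forall>z\<in>K. norm (g z - b (\<psi> z)) < e / (2 * (\<bar>C\<bar> + 1))"
      using g e' unfolding local_closure_def by blast
    obtain c where c: "c > 0" "\<And>x. x \<in> topspace M \<Longrightarrow> norm (b x) \<le> c"
      using uniform_algebra_bounded [OF alg b(1)] by blast
    have "e / (2 * c) > 0"
      using e c by simp
    then obtain a where a: "a \<in> A" "\<forall>z\<in>K. norm (f z - a (\<psi> z)) < e / (2 * c)"
      using f unfolding local_closure_def by blast
    have "mult_on M a b \<in> A"
      using a b alg by (simp add: uniform_algebra_def subalgebra_of_C_def)
    moreover have "norm (f z * g z - mult_on M a b (\<psi> z)) < e" if z: "z \<in> K" for z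
    proof -
      have "f z * g z - mult_on M a b (\<psi> z) = f z * (g z - b (\<psi> z)) + (f z - a (\<psi> z)) * b (\<psi> z)"
        using K [OF z] by (simp add: mult_on_def algebra_simps)
      also have "norm \<dots> \<le> norm (f z) * norm (g z - b (\<psi> z)) + norm (f z - a (\<psi> z)) * norm (b (\<psi> z))"
        by (rule order_trans [OF norm_triangle_ineq]) (simp add: norm_mult)
      also have "norm (f z) * norm (g z - b (\<psi> z)) \<le> (\<bar>C\<bar> + 1) * norm (g z - b (\<psi> z))"
        using C z by (intro mult_right_mono) fastforce+
      also have "\<dots> < (\<bar>C\<bar> + 1) * (e / (2 * (\<bar>C\<bar> + 1)))"
        using b z by (intro mult_strict_left_mono) auto
      also have "\<dots> = e / 2"
        by (simp add: field_simps)
      also have "norm (f z - a (\<psi> z)) * norm (b (\<psi> z)) \<le> e / (2 * c) * c"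
        using a z c K [OF z] e by (intro mult_mono) (auto simp: less_imp_le)
      also have "e / (2 * c) * c = e / 2"
        using c by simp
      finally show ?thesis by simp
    qed
    ultimately show "\<exists>a\<in>A. \<forall>z\<in>K. norm (f z * g z - a (\<psi> z)) < e"
      by blast
  qed
  show "f \<in> local_closure K" if f: "\<And>e. e > 0 \<Longrightarrow> \<exists>g\<in>local_closure K. \<forall>z\<in>K. norm (f z - g z) < e" for f
    unfolding local_closure_def
  proof (intro CollectI allI impI)
    fix e :: real assume "e > 0"
    then have e2: "e / 2 > 0" by simp
    obtain g where g: "g \<in> local_closure K" "\<forall>z\<in>K. norm (f z - g z) < e / 2"
      using f [OF e2] by blast
    obtain a where a: "a \<in> A" "\<forall>z\<in>K. norm (g z - a (\<psi> z)) < e / 2"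
      using g(1) e2 unfolding local_closure_def by blast
    have "norm (f z - a (\<psi> z)) < e" if "z \<in> K" for z
      using norm_diff_triangle_less [of "f z" "g z" "e / 2" "a (\<psi> z)" "e / 2"] g(2) a(2) that by simp
    then show "\<exists>a\<in>A. \<forall>z\<in>K. norm (f z - a (\<psi> z)) < e"
      using a(1) by blast
  qed
qed

text \<open>A partition-of-unity argument in miniature: multiplying by a member of \<^term>\<open>A\<close> supported
  in the disc turns approximability on the disc into membership in \<^term>\<open>A\<close>.\<close>

lemma not_essential_if_locally_dense:
  assumes r: "r > 0" "cball p r \<subseteq> D"
    and dense: "\<And>h. continuous_on (cball p r) h \<Longrightarrow> h \<in> local_closure (cball p r)"
  shows "\<not> essential_algebra M A"
proof
  assume ess: "essential_algebra M A"
  have ball_D: "ball p r \<subseteq> D"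
    using r ball_subset_cball by blast
  obtain \<phi> where \<phi>: "\<phi> \<in> A" "\<phi> (\<psi> p) = 1" "\<And>x. \<lbrakk>x \<in> topspace M; x \<notin> \<psi> ` ball p r\<rbrakk> \<Longrightarrow> \<phi> x = 0"
    using bump [OF open_ball ball_D, of p] r by auto
  obtain b where b: "b > 0" "\<And>x. x \<in> topspace M \<Longrightarrow> norm (\<phi> x) \<le> b"
    using uniform_algebra_bounded [OF alg \<phi>(1)] by blast
  have \<phi>_cont: "continuous_map M euclidean \<phi>"
    using uniform_algebra_continuous_map [OF alg \<phi>(1)] .
  \<comment> \<open>A closed set that misses \<open>\<psi> p\<close>; if \<open>A\<close> contains
    everything vanishing on it, the essential set cannot be the whole space.\<close>
  define E where "E = {x \<in> topspace M. norm (\<phi> x) \<le> 1/2}"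
  have "closedin M {x \<in> topspace M. \<phi> x \<in> cball 0 (1/2)}"
    by (rule closedin_continuous_map_preimage [OF \<phi>_cont]) auto
  then have "closedin M E"
    by (simp add: E_def)
  moreover have "contains_all_vanishing_on M A E"
    unfolding contains_all_vanishing_on_def
  proof (intro ballI impI)
    fix k assume k: "k \<in> mspace (C_space M)" and k0: "\<forall>x\<in>E. k x = 0"
    have k_cont: "continuous_map M euclidean k"
      using k mspace_C_space [OF uniform_algebra_compact_space [OF alg]] by blast
    \<comment> \<open>The quotient of \<open>k\<close> by \<open>\<phi>\<close>, with the squared
      modulus in the denominator cut off at 1/4 for continuity. The cutoff is harmless: off
      \<open>E\<close> the squared modulus exceeds 1/4, and on \<open>E\<close> the function
      \<open>k\<close> vanishes.\<close>
    define h where "h = (\<lambda>z. k (\<psi> z) * cnj (\<phi> (\<psi> z)) / of_real (max ((norm (\<phi> (\<psi> z)))\<^sup>2) (1/4)))"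
    have "continuous_on (cball p r) h"
      unfolding h_def
      by (intro continuous_intros continuous_on_subset [OF continuous_on_pullback [OF k_cont] r(2)]
          continuous_on_subset [OF continuous_on_pullback [OF \<phi>_cont] r(2)]) (auto simp: max_def)
    then have h: "h \<in> local_closure (cball p r)"
      by (rule dense)
    have k_eq: "k (\<psi> z) = \<phi> (\<psi> z) * h z" if "z \<in> D" for z
    proof (cases "\<psi> z \<in> E")
      case True
      then show ?thesis
        using k0 by (simp add: h_def)
    next
      case False
      then have "1/2 < norm (\<phi> (\<psi> z))"
        using \<psi>_topspace [OF that] by (auto simp: E_def)
      moreover from this have "(1/2)\<^sup>2 < (norm (\<phi> (\<psi> z)))\<^sup>2"
        by (intro power_strict_mono) auto
      ultimately have "max ((norm (\<phi> (\<psi> z)))\<^sup>2) (1/4) = (norm (\<phi> (\<psi> z)))\<^sup>2" "\<phi> (\<psi> z) \<noteq> 0"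
        by (auto simp: power2_eq_square max_def)
      then show ?thesis
        unfolding h_def by (simp only: complex_norm_square) (simp add: field_simps)
    qed
    show "k \<in> A"
    proof (rule uniform_algebra_closed [OF alg k])
      fix e :: real assume e: "e > 0"
      then have "e / b > 0"
        using b by simp
      then obtain a where a: "a \<in> A" "\<forall>z\<in>cball p r. norm (h z - a (\<psi> z)) < e / b"
        using h unfolding local_closure_def by blast
      have "mult_on M \<phi> a \<in> A"
        using a \<phi> alg by (simp add: uniform_algebra_def subalgebra_of_C_def)
      moreover have "norm (k x - mult_on M \<phi> a x) < e" if x: "x \<in> topspace M" for x
      proof (cases "x \<in> \<psi> ` ball p r")
        case True
        then obtain z where z: "z \<in> cball p r" "x = \<psi> z"
          using ball_subset_cball by blast
        then have "norm (k x - mult_on M \<phi> a x) = norm (\<phi> x) * norm (h z - a (\<psi> z))"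
          using k_eq x r by (auto simp: mult_on_def norm_mult [symmetric] right_diff_distrib)
        also have "\<dots> \<le> b * norm (h z - a (\<psi> z))"
          using b x by (intro mult_right_mono) auto
        also have "\<dots> < b * (e / b)"
          using b a z by (intro mult_strict_left_mono) auto
        finally show ?thesis
          using b by simp
      next
        case False
        then have "\<phi> x = 0"
          using \<phi> x by blast
        moreover from this have "k x = 0"
          using k0 x by (simp add: E_def)
        ultimately show ?thesis
          using x e by (simp add: mult_on_def)
      qed
      ultimately show "\<exists>a\<in>A. \<forall>x\<in>topspace M. norm (k x - a x) < e"
        by blast
    qed
  qed
  ultimately have "topspace M \<subseteq> E"
    using ess by (simp add: essential_algebra_def is_essential_set_def)
  then have "\<psi> p \<in> E"
    using \<psi>_topspace r by (meson centre_in_cball less_eq_real_def subsetD)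
  then show False
    using \<phi> by (simp add: E_def)
qed

text \<open>Independent differentials at \<open>p\<close> allow combinations \<open>P\<close>,
  \<open>Q\<close> of \<open>f\<close>, \<open>g\<close> with differentials \<open>dx\<close>,
  \<open>dy\<close> at \<open>p\<close>. Gaussians in \<open>P\<close> and \<open>Q\<close> then
  yield the coordinates near \<open>p\<close>, and Stone-Weierstrass yields density on a
  disc.\<close>

lemma not_essential_if_wedge_nonzero:
  assumes f: "f \<in> A" "has_C1_partials D (\<lambda>z. f (\<psi> z)) fx fy"
    and g: "g \<in> A" "has_C1_partials D (\<lambda>z. g (\<psi> z)) gx gy"
    and p: "p \<in> D" and wedge: "fx p * gy p \<noteq> fy p * gx p"
  shows "\<not> essential_algebra M A"
proof -
  define \<Delta> where "\<Delta> = fx p * gy p - fy p * gx p"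
  have \<Delta>: "\<Delta> \<noteq> 0"
    using wedge by (simp add: \<Delta>_def)
  \<comment> \<open>The coefficients of \<open>P\<close> and \<open>Q\<close> are the rows of the
    inverse of the matrix of partials at \<open>p\<close>.\<close>
  define P where "P = (\<lambda>z. gy p / \<Delta> * f (\<psi> z) + (- fy p / \<Delta>) * g (\<psi> z))"
  define Q where "Q = (\<lambda>z. (- gx p / \<Delta>) * f (\<psi> z) + fx p / \<Delta> * g (\<psi> z))"
  let ?\<epsilon> = "exp (-5) / 400 :: real"
  note P_C1 = has_C1_partials_linear_combination [OF f(2) g(2), of "gy p / \<Delta>" "- fy p / \<Delta>", folded P_def]
  note Q_C1 = has_C1_partials_linear_combination [OF f(2) g(2), of "- gx p / \<Delta>" "fx p / \<Delta>", folded Q_def]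
  have \<epsilon>: "?\<epsilon> > 0"
    by simp
  have "gy p / \<Delta> * fx p + - fy p / \<Delta> * gx p = (fx p * gy p - fy p * gx p) / \<Delta>"
    "- gx p / \<Delta> * fy p + fx p / \<Delta> * gy p = (fx p * gy p - fy p * gx p) / \<Delta>"
    "gy p / \<Delta> * fy p + - fy p / \<Delta> * gy p = 0" "- gx p / \<Delta> * fx p + fx p / \<Delta> * gx p = 0"
    by (simp_all add: diff_divide_distrib)
  then have coeffs: "gy p / \<Delta> * fx p + - fy p / \<Delta> * gx p = 1" "- gx p / \<Delta> * fy p + fx p / \<Delta> * gy p = 1"
    "gy p / \<Delta> * fy p + - fy p / \<Delta> * gy p = 0" "- gx p / \<Delta> * fx p + fx p / \<Delta> * gx p = 0"
    using \<Delta> unfolding \<Delta>_def [symmetric] by simp_all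
  obtain r1 where r1: "r1 > 0" "cball p r1 \<subseteq> D"
    "\<And>x y. \<lbrakk>x \<in> cball p r1; y \<in> cball p r1\<rbrakk> \<Longrightarrow> norm (P x - P y - of_real (Re (x - y))) \<le> ?\<epsilon> * norm (x - y)"
    using has_C1_partials_approx_linear [OF P_C1 open_D p \<epsilon>] unfolding coeffs by auto
  obtain r2 where r2: "r2 > 0" "cball p r2 \<subseteq> D"
    "\<And>x y. \<lbrakk>x \<in> cball p r2; y \<in> cball p r2\<rbrakk> \<Longrightarrow> norm (Q x - Q y - of_real (Im (x - y))) \<le> ?\<epsilon> * norm (x - y)"
    using has_C1_partials_approx_linear [OF Q_C1 open_D p \<epsilon>] unfolding coeffs by auto
  \<comment> \<open>Halved because \<open>lipschitz_mem\<close> needs the estimates on the disc of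
    radius \<open>2 * r\<close>.\<close>
  define r where "r = min r1 r2 / 2"
  have r: "r > 0" "cball p (2 * r) \<subseteq> cball p r1" "cball p (2 * r) \<subseteq> cball p r2" "cball p r \<subseteq> D"
    using r1 r2 by (auto simp: r_def subset_iff)
  interpret loc: closed_function_algebra "cball p r" "local_closure (cball p r)"
    by (rule closed_function_algebra_local_closure [OF r(4)])
  have PQ: "P \<in> local_closure (cball p r)" "Q \<in> local_closure (cball p r)"
    unfolding P_def Q_def by (intro loc.add loc.mult loc.const local_closureI f(1) g(1))+
  have lip: "h \<in> local_closure (cball p r)" if "\<And>x y. norm (h x - h y) \<le> 1 * norm (x - y)" for h
  proof (rule loc.lipschitz_mem [where X = "\<lambda>z. z" and p = p and r = r and P = P and Q = Q and L = 1])
    fix x y assume "x \<in> cball p (2 * r)" "y \<in> cball p (2 * r)"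
    then show "norm (P x - P y - of_real (Re (x - y))) \<le> ?\<epsilon> * norm (x - y)"
      "norm (Q x - Q y - of_real (Im (x - y))) \<le> ?\<epsilon> * norm (x - y)"
      using r r1(3) r2(3) by (meson subsetD)+
  qed (use r PQ that in auto)
  have "(\<lambda>z. complex_of_real (Re z)) \<in> local_closure (cball p r)" "(\<lambda>z. complex_of_real (Im z)) \<in> local_closure (cball p r)"
    by (rule lip; simp flip: of_real_diff minus_complex.sel add: abs_Re_le_cmod abs_Im_le_cmod)+
  then have "h \<in> local_closure (cball p r)" if "continuous_on (cball p r) h" for h
    using loc.continuous_mem [where X = "\<lambda>z. z", OF compact_cball _ _ _ that] by simp
  then show ?thesis
    by (rule not_essential_if_locally_dense [OF r(1,4)])
qed

text \<open>Were the Jacobian of \<open>f\<close> nonzero at \<open>p\<close>, then \<open>f\<close>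
  would be a local coordinate in which all generators, and by uniform limits all of
  \<open>A\<close>, are holomorphic. A bump function near \<open>p\<close> contradicts the identity
  theorem.\<close>

lemma jacobian_zero_if_wedges_zero:
  assumes gen: "generates M F A" and F: "\<And>f. f \<in> F \<Longrightarrow> has_C1_partials D (\<lambda>z. f (\<psi> z)) (fx f) (fy f)"
    and wedge: "\<And>f g z. \<lbrakk>f \<in> F; g \<in> F; z \<in> D\<rbrakk> \<Longrightarrow> fx f z * fy g z = fy f z * fx g z"
    and f: "f \<in> F" and p: "p \<in> D"
  shows "Im (cnj (fx f p) * fy f p) = 0"
proof (rule ccontr)
  assume J: "Im (cnj (fx f p) * fy f p) \<noteq> 0"
  obtain V \<Omega> h h' where V: "open V" "V \<subseteq> D" "p \<in> V" "open \<Omega>" "f (\<psi> p) \<in> \<Omega>" "homeomorphism V \<Omega> (\<lambda>z. f (\<psi> z)) h"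
    and h: "\<And>w. w \<in> \<Omega> \<Longrightarrow> (h has_derivative h' w) (at w)"
    and h': "\<And>w v. w \<in> \<Omega> \<Longrightarrow> fx f (h w) * of_real (Re (h' w v)) + fy f (h w) * of_real (Im (h' w v)) = v"
    by (rule has_C1_partials_local_inverse [OF F [OF f] open_D p J]) (rule that; assumption)
  have hD: "h w \<in> D" if "w \<in> \<Omega>" for w
    using V(2,6) that by (auto simp: homeomorphism_def)
  have hol_F: "(\<lambda>w. g (\<psi> (h w))) holomorphic_on \<Omega>" if g: "g \<in> F" for g
    unfolding holomorphic_on_open [OF V(4)]
  proof
    fix w assume w: "w \<in> \<Omega>"
    show "\<exists>c. ((\<lambda>w. g (\<psi> (h w))) has_field_derivative c) (at w)"
      using F [OF g] hD [OF w] h [OF w] h' [OF w] wedge [OF f g hD [OF w]]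
      by (rule holomorphic_in_proportional_coordinate)
  qed
  have hol_poly: "(\<lambda>w. P (\<psi> (h w))) holomorphic_on \<Omega>" if P: "P \<in> polynomials_in M F" for P
  proof -
    obtain G and I :: "(('a \<Rightarrow> complex) \<Rightarrow> nat) set" and c where G: "G \<subseteq> F"
      and P_eq: "P = restrict (\<lambda>x. \<Sum>m\<in>I. c m * (\<Prod>g\<in>G. g x ^ m g)) (topspace M)"
      using P unfolding polynomials_in_def by blast
    have "(\<lambda>w. \<Sum>m\<in>I. c m * (\<Prod>g\<in>G. g (\<psi> (h w)) ^ m g)) holomorphic_on \<Omega>"
      using G by (intro holomorphic_intros hol_F) auto
    then show ?thesis
      by (rule holomorphic_transform) (simp add: P_eq \<psi>_topspace hD)
  qed
  have hol: "(\<lambda>w. a (\<psi> (h w))) holomorphic_on \<Omega>" if a: "a \<in> A" for a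
  proof -
    have "\<exists>P. P \<in> polynomials_in M F \<and> (\<forall>x\<in>topspace M. norm (a x - P x) < inverse (real (Suc n)))" for n
      using generates_approx [OF alg gen a, of "inverse (real (Suc n))"] by (metis inverse_positive_iff_positive of_nat_0_less_iff zero_less_Suc)
    then obtain P where P: "\<And>n. P n \<in> polynomials_in M F"
      "\<And>n x. x \<in> topspace M \<Longrightarrow> norm (a x - P n x) < inverse (real (Suc n))"
      by metis
    have "uniform_limit \<Omega> (\<lambda>n w. P n (\<psi> (h w))) (\<lambda>w. a (\<psi> (h w))) sequentially"
    proof (rule uniform_limitI)
      fix e :: real assume "e > 0"
      then obtain N where N: "inverse (real (Suc N)) < e"
        using reals_Archimedean by blast
      have "dist (P n (\<psi> (h w))) (a (\<psi> (h w))) < e" if "n \<ge> N" "w \<in> \<Omega>" for n w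
      proof -
        have "dist (P n (\<psi> (h w))) (a (\<psi> (h w))) < inverse (real (Suc n))"
          using P(2) [OF \<psi>_topspace [OF hD [OF that(2)]]] by (simp add: dist_norm norm_minus_commute)
        also have "\<dots> \<le> inverse (real (Suc N))"
          using that(1) by (intro le_imp_inverse_le) auto
        finally show ?thesis
          using N by linarith
      qed
      then show "\<forall>\<^sub>F n in sequentially. \<forall>w\<in>\<Omega>. dist (P n (\<psi> (h w))) (a (\<psi> (h w))) < e"
        unfolding eventually_sequentially by blast
    qed
    then have "\<exists>d>0. cball w d \<subseteq> \<Omega> \<and> uniform_limit (cball w d) (\<lambda>n w. P n (\<psi> (h w))) (\<lambda>w. a (\<psi> (h w))) sequentially"
      if "w \<in> \<Omega>" for w
      using that V(4) open_contains_cball by (meson uniform_limit_on_subset)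
    with V(4) hol_poly [OF P(1)] show ?thesis
      by (rule holomorphic_uniform_sequence)
  qed
  define w0 where "w0 = f (\<psi> p)"
  obtain r where r: "r > 0" "ball w0 r \<subseteq> \<Omega>"
    using V open_contains_ball unfolding w0_def by blast
  have hw0: "h w0 = p"
    using V(3,6) unfolding w0_def homeomorphism_def by auto
  define V' where "V' = h ` ball w0 (r / 2)"
  \<comment> \<open>Writing the image under \<open>h\<close> as a preimage under the continuous
    coordinate shows that it is open.\<close>
  have V'_eq: "V' = V \<inter> (\<lambda>z. f (\<psi> z)) -` ball w0 (r / 2)"
  proof -
    have "ball w0 (r / 2) \<subseteq> \<Omega>"
      using r by (auto simp: subset_iff)
    then show ?thesis
      using V(6) unfolding V'_def homeomorphism_def by (force simp: image_iff)
  qed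
  have "open V'"
    unfolding V'_eq by (intro continuous_open_preimage homeomorphism_cont1 [OF V(6)] V(1) open_ball)
  moreover have "V' \<subseteq> D" "p \<in> V'"
    using hD r hw0 by (auto simp: V'_def subset_iff intro!: image_eqI [of _ _ w0])
  ultimately obtain a where a: "a \<in> A" "a (\<psi> p) = 1" "\<And>x. \<lbrakk>x \<in> topspace M; x \<notin> \<psi> ` V'\<rbrakk> \<Longrightarrow> a x = 0"
    by (rule bump) (rule that; assumption)
  have "a (\<psi> (h w0)) = 0"
  \<comment> \<open>The bump function vanishes on the annulus, because injectivity of
    \<open>h\<close> and \<open>\<psi>\<close> keeps the annulus away from the support; continuation
    carries the zero to the centre, where the value is 1.\<close>
  proof (rule analytic_continuation_open [of "ball w0 r - cball w0 (r / 2)" "ball w0 r" "\<lambda>w. a (\<psi> (h w))" "\<lambda>_. 0"])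
    show "(\<lambda>w. a (\<psi> (h w))) holomorphic_on ball w0 r"
      using hol [OF a(1)] r(2) by (rule holomorphic_on_subset)
    have "w0 + of_real (3 / 4 * r) \<in> ball w0 r - cball w0 (r / 2)"
      using r by (simp add: dist_norm norm_mult)
    then show "ball w0 r - cball w0 (r / 2) \<noteq> {}"
      by blast
    fix w assume w: "w \<in> ball w0 r - cball w0 (r / 2)"
    have "\<psi> (h w) \<notin> \<psi> ` V'"
    proof
      assume "\<psi> (h w) \<in> \<psi> ` V'"
      then obtain w' where w': "w' \<in> ball w0 (r / 2)" "\<psi> (h w) = \<psi> (h w')"
        by (auto simp: V'_def)
      have \<Omega>: "w \<in> \<Omega>" "w' \<in> \<Omega>"
        using w w' r by (auto simp: subset_iff)
      then have "h w = h w'"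
        using w'(2) \<psi>_inj hD by (auto simp: inj_on_def)
      then have "w = w'"
        using \<Omega> V(6) by (metis homeomorphism_apply2)
      then show False
        using w w' by auto
    qed
    then show "a (\<psi> (h w)) = 0"
      using a(3) \<psi>_topspace hD w r by blast
  qed (use r in auto)
  then show False
    using a(2) hw0 by simp
qed

lemma not_essential_if_generated_by_C1:
  assumes gen: "generates M F A" and F: "\<And>f. f \<in> F \<Longrightarrow> \<exists>fx fy. has_C1_partials D (\<lambda>z. f (\<psi> z)) fx fy"
    and D: "D \<noteq> {}"
  shows "\<not> essential_algebra M A"
proof
  assume ess: "essential_algebra M A"
  obtain fx fy where F: "\<And>f. f \<in> F \<Longrightarrow> has_C1_partials D (\<lambda>z. f (\<psi> z)) (fx f) (fy f)"
    using F by metis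
  have FA: "F \<subseteq> A"
    using gen by (simp add: generates_def)
  have wedge: "fx f z * fy g z = fy f z * fx g z" if "f \<in> F" "g \<in> F" "z \<in> D" for f g z
    using not_essential_if_wedge_nonzero F FA ess that by (meson subsetD)
  have rank: "Im (cnj (fx f z) * fy f z) = 0" if "f \<in> F" "z \<in> D" for f z
    by (rule jacobian_zero_if_wedges_zero [OF gen F wedge that])
  obtain p where p: "p \<in> D"
    using D by blast
  have "\<exists>x\<in>D. \<exists>y\<in>D. x \<noteq> y \<and> (\<forall>f\<in>F. f (\<psi> x) = f (\<psi> y))"
    by (rule rank_one_family_not_separating [OF open_D p F wedge rank])
  then obtain x y where xy: "x \<in> D" "y \<in> D" "x \<noteq> y" "\<And>f. f \<in> F \<Longrightarrow> f (\<psi> x) = f (\<psi> y)"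
    by blast
  have "\<psi> x \<noteq> \<psi> y"
    using xy \<psi>_inj by (auto simp: inj_on_def)
  then obtain a where a: "a \<in> A" "a (\<psi> x) \<noteq> a (\<psi> y)"
    using alg xy \<psi>_topspace unfolding uniform_algebra_def by meson
  \<comment> \<open>Half the gap: an approximating polynomial takes equal values at the two points,
    so the gap would be less than \<open>e + e\<close>, which is the gap itself.\<close>
  define e where "e = norm (a (\<psi> x) - a (\<psi> y)) / 2"
  have "e > 0"
    using a by (simp add: e_def)
  then obtain P where P: "P \<in> polynomials_in M F" "\<And>x. x \<in> topspace M \<Longrightarrow> norm (a x - P x) < e"
    using generates_approx [OF alg gen a(1)] by metis
  have "P (\<psi> x) = P (\<psi> y)"
  proof -
    obtain G and I :: "(('a \<Rightarrow> complex) \<Rightarrow> nat) set" and c where G: "G \<subseteq> F"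
      and P_eq: "P = restrict (\<lambda>x. \<Sum>m\<in>I. c m * (\<Prod>g\<in>G. g x ^ m g)) (topspace M)"
      using P(1) unfolding polynomials_in_def by blast
    have "(\<Prod>g\<in>G. g (\<psi> x) ^ m g) = (\<Prod>g\<in>G. g (\<psi> y) ^ m g)" for m
      using G xy(4) by (intro prod.cong refl) (metis subsetD)
    then show ?thesis
      using xy by (simp add: P_eq \<psi>_topspace)
  qed
  then have "norm (a (\<psi> x) - a (\<psi> y)) < e + e"
    using P(2) [OF \<psi>_topspace [OF xy(1)]] P(2) [OF \<psi>_topspace [OF xy(2)]]
      norm_diff_triangle_less [of "a (\<psi> x)" "P (\<psi> x)" e "a (\<psi> y)" e]
    by (simp add: norm_minus_commute)
  then show False
    by (simp add: e_def)
qed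

end

section \<open>Charts\<close>

text \<open>Charts take values in \<open>real^2\<close>, while the complex analysis happens on
  \<open>complex\<close>; this is the linear isomorphism between them.\<close>

definition to_plane :: "complex \<Rightarrow> real^2" where
  "to_plane z = vector [Re z, Im z]"

lemma to_plane_nth [simp]: "to_plane z $ 1 = Re z" "to_plane z $ 2 = Im z"
  by (simp_all add: to_plane_def)

lemma bounded_linear_to_plane: "bounded_linear to_plane"
  by (rule linear_conv_bounded_linear [THEN iffD1])
     (auto intro!: linearI simp: vec_eq_iff forall_2)

lemma continuous_on_to_plane: "continuous_on S to_plane"
  by (rule linear_continuous_on [OF bounded_linear_to_plane])

lemma to_plane_Complex: "to_plane (Complex (p $ 1) (p $ 2)) = p"
  by (simp add: vec_eq_iff forall_2)

lemma inj_to_plane: "inj to_plane"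
  by (auto simp: inj_def vec_eq_iff forall_2 complex_eq_iff)

lemma open_image_to_plane:
  assumes "open V"
  shows "open (to_plane ` V)"
proof -
  have "to_plane ` V = (\<lambda>p. Complex (p $ 1) (p $ 2)) -` V"
    using to_plane_Complex by (force simp: complex_eq_iff image_iff vec_eq_iff forall_2)
  moreover have "continuous_on UNIV (\<lambda>p :: real^2. Complex (p $ 1) (p $ 2))"
    unfolding Complex_eq by (intro continuous_intros)
  ultimately show ?thesis
    using assms by (simp add: open_vimage)
qed

text \<open>On an open subset of \<open>W\<close> the local extensions coincide with
  \<open>f\<close> itself, so their continuous derivatives are those of \<open>f\<close>.\<close>

lemma C1_on_imp_has_C1_partials:
  assumes f: "C1_on W f" and "open D" "to_plane ` D \<subseteq> W"
  shows "\<exists>fx fy. has_C1_partials D (\<lambda>z. f (to_plane z)) fx fy"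
proof -
  \<comment> \<open>The local extensions give a derivative near each point only; the Frechet
    derivative is a single function agreeing with all of them, by uniqueness.\<close>
  define f' where "f' = (\<lambda>p. frechet_derivative f (at p))"
  have open_TD: "open (to_plane ` D)"
    using assms(2) by (rule open_image_to_plane)
  have loc: "\<exists>V f0'. open V \<and> to_plane z \<in> V \<and> V \<subseteq> to_plane ` D \<and> continuous_on V f0' \<and>
      (\<forall>q\<in>V. (f has_derivative blinfun_apply (f0' q)) (at q))" if z: "z \<in> D" for z
  proof -
    have "to_plane z \<in> W"
      using z assms(3) by blast
    from bspec [OF f [unfolded C1_on_def] this]
    obtain V g where V: "open V" "to_plane z \<in> V" "C1_on_open V g" "\<forall>q\<in>W \<inter> V. g q = f q"
      by (elim exE conjE)
    then obtain g' where g': "\<And>q. q \<in> V \<Longrightarrow> (g has_derivative blinfun_apply (g' q)) (at q)" "continuous_on V g'"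
      unfolding C1_on_open_def by blast
    let ?V = "V \<inter> to_plane ` D"
    have V': "open ?V"
      using V(1) open_TD by blast
    have "(f has_derivative blinfun_apply (g' q)) (at q)" if q: "q \<in> ?V" for q
    proof (rule has_derivative_transform_within_open [OF g'(1) V' q])
      show "g x = f x" if "x \<in> ?V" for x
        using that V(4) assms(3) by blast
    qed (use q in blast)
    then show ?thesis
      using V V' z g'(2) by (intro exI [of _ ?V] exI [of _ g']) (auto intro: continuous_on_subset)
  qed
  have deriv: "(f has_derivative f' (to_plane z)) (at (to_plane z))" if "z \<in> D" for z
    using loc [OF that] unfolding f'_def by (metis differentiableI frechet_derivative_works)
  have cont: "continuous_on D (\<lambda>z. f' (to_plane z) v)" for v
    unfolding continuous_on_eq_continuous_at [OF assms(2)]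
  proof
    fix z assume z: "z \<in> D"
    obtain V f0' where V: "open V" "to_plane z \<in> V" "V \<subseteq> to_plane ` D" "continuous_on V f0'"
      and f0': "\<And>q. q \<in> V \<Longrightarrow> (f has_derivative blinfun_apply (f0' q)) (at q)"
      using loc [OF z] by blast
    let ?U = "to_plane -` V"
    have U: "open ?U" "z \<in> ?U"
      using V continuous_on_to_plane by (auto intro: open_vimage)
    have "continuous_on ?U (\<lambda>z. blinfun_apply (f0' (to_plane z)) v)"
      by (intro continuous_intros continuous_on_compose2 [OF V(4) continuous_on_to_plane]) auto
    moreover have "blinfun_apply (f0' (to_plane y)) v = f' (to_plane y) v" if "y \<in> ?U" for y
      using frechet_derivative_at [OF f0'] that unfolding f'_def by (metis vimageD)
    ultimately have "continuous_on ?U (\<lambda>z. f' (to_plane z) v)"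
      by (subst continuous_on_cong [OF refl]) auto
    then show "isCont (\<lambda>z. f' (to_plane z) v) z"
      using U continuous_on_eq_continuous_at by blast
  qed
  have "((\<lambda>z. f (to_plane z)) has_derivative
      (\<lambda>v. f' (to_plane z) (to_plane 1) * of_real (Re v) + f' (to_plane z) (to_plane \<i>) * of_real (Im v))) (at z)"
    if z: "z \<in> D" for z
  proof -
    interpret f': linear "f' (to_plane z)"
      using deriv [OF z] by (rule has_derivative_linear)
    have "to_plane v = Re v *\<^sub>R to_plane 1 + Im v *\<^sub>R to_plane \<i>" for v
      by (simp add: vec_eq_iff forall_2)
    then have "f' (to_plane z) (to_plane v) =
        f' (to_plane z) (to_plane 1) * of_real (Re v) + f' (to_plane z) (to_plane \<i>) * of_real (Im v)" for v
      by (metis f'.add f'.scaleR scaleR_conv_of_real mult.commute)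
    then have "(\<lambda>v. f' (to_plane z) (to_plane v)) =
        (\<lambda>v. f' (to_plane z) (to_plane 1) * of_real (Re v) + f' (to_plane z) (to_plane \<i>) * of_real (Im v))"
      by (rule ext)
    with has_derivative_compose [OF bounded_linear_imp_has_derivative [OF bounded_linear_to_plane] deriv [OF z]]
    show ?thesis
      by (simp only:)
  qed
  then have "has_C1_partials D (\<lambda>z. f (to_plane z))
      (\<lambda>z. f' (to_plane z) (to_plane 1)) (\<lambda>z. f' (to_plane z) (to_plane \<i>))"
    using cont by (simp add: has_C1_partials_def)
  then show ?thesis
    by (intro exI)
qed

text \<open>A relatively open set that contains a boundary point also contains points slightly above
  it, so one can always move off the boundary.\<close>

lemma relatively_open_half_plane_interior:
  assumes "openin (top_of_set half_plane) W" "W \<noteq> {}"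
  obtains D where "open D" "D \<noteq> {}" "to_plane ` D \<subseteq> W"
proof -
  obtain O' where O': "open O'" "W = half_plane \<inter> O'"
    using assms(1) openin_open by metis
  define D where "D = to_plane -` O' \<inter> {z. Im z > 0}"
  have "open D"
    unfolding D_def using O' continuous_on_to_plane
    by (intro open_Int open_vimage open_halfspace_Im_gt) auto
  moreover have "D \<noteq> {}"
  proof -
    obtain q :: "real^2" where "q \<in> O'" "q $ 2 \<ge> 0"
      using assms(2) O'(2) by (auto simp: half_plane_def)
    then obtain z where z: "to_plane z \<in> O'" "Im z \<ge> 0"
      using to_plane_Complex [of q] by (metis complex.sel(2))
    have "open (to_plane -` O')"
      using O' continuous_on_to_plane by (intro open_vimage) auto
    then obtain r where r: "r > 0" "ball z r \<subseteq> to_plane -` O'"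
      using z open_contains_ball by blast
    have "z + \<i> * of_real (r / 2) \<in> ball z r"
      using r by (simp add: dist_norm norm_mult)
    then have "z + \<i> * of_real (r / 2) \<in> D"
      using r z unfolding D_def by auto
    then show ?thesis by blast
  qed
  moreover have "to_plane ` D \<subseteq> W"
    using O' by (auto simp: D_def half_plane_def)
  ultimately show ?thesis
    by (rule that)
qed

section \<open>From charts to planar pieces\<close>

lemma chart_inverse_continuous_map:
  assumes "is_chart M (U, \<phi>)"
  shows "continuous_map (top_of_set (\<phi> ` U)) M (inv_into U \<phi>)"
proof -
  have U: "U \<subseteq> topspace M" and hom: "homeomorphic_map (subtopology M U) (top_of_set (\<phi> ` U)) \<phi>"
    using assms by (auto simp: is_chart_def openin_subset)
  obtain g where g: "homeomorphic_maps (subtopology M U) (top_of_set (\<phi> ` U)) \<phi> g"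
    using hom homeomorphic_map_maps by blast
  have top: "topspace (subtopology M U) = U"
    using U by auto
  have "inv_into U \<phi> q = g q" if "q \<in> \<phi> ` U" for q
  proof -
    have "inj_on \<phi> U"
      using hom top by (auto simp: homeomorphic_map_def dest: homeomorphic_imp_injective_map)
    moreover have "g q \<in> U" "\<phi> (g q) = q"
      using g that top by (auto simp: homeomorphic_maps_def continuous_map_def)
    ultimately show ?thesis
      by (metis inv_into_f_f)
  qed
  moreover have "continuous_map (top_of_set (\<phi> ` U)) M g"
    using g by (simp add: homeomorphic_maps_def continuous_map_in_subtopology)
  ultimately show ?thesis
    by (metis (no_types, lifting) continuous_map_eq topspace_euclidean_subtopology)
qed

lemma chart_piece:
  assumes alg: "uniform_algebra M A" "regular_on M A" and chart: "is_chart M (U, \<phi>)"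
    and D: "open D" "to_plane ` D \<subseteq> \<phi> ` U"
  shows "regular_algebra_on_planar_piece M A D (\<lambda>z. inv_into U \<phi> (to_plane z))"
proof
  have U: "openin M U" and hom: "homeomorphic_map (subtopology M U) (top_of_set (\<phi> ` U)) \<phi>"
    using chart by (auto simp: is_chart_def)
  have top: "topspace (subtopology M U) = U"
    using openin_subset [OF U] by auto
  have inj: "inj_on \<phi> U"
    using homeomorphic_imp_injective_map [OF hom] top by simp
  have "continuous_map (top_of_set D) (top_of_set (\<phi> ` U)) to_plane"
    using D continuous_on_to_plane by (auto simp: image_subset_iff_funcset)
  from continuous_map_compose [OF this chart_inverse_continuous_map [OF chart]]
  show "continuous_map (top_of_set D) M (\<lambda>z. inv_into U \<phi> (to_plane z))"
    by (simp add: o_def)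
  show "inj_on (\<lambda>z. inv_into U \<phi> (to_plane z)) D"
  proof (rule inj_onI)
    fix x y assume xy: "x \<in> D" "y \<in> D" "inv_into U \<phi> (to_plane x) = inv_into U \<phi> (to_plane y)"
    then have "to_plane x = to_plane y"
      using D(2) by (intro inv_into_injective [OF xy(3)]) auto
    then show "x = y"
      by (rule injD [OF inj_to_plane])
  qed
  show "openin M ((\<lambda>z. inv_into U \<phi> (to_plane z)) ` V)" if V: "open V" "V \<subseteq> D" for V
  proof -
    \<comment> \<open>As a preimage under the continuous chart map, the image is open in
      \<open>U\<close>, hence in \<open>M\<close>.\<close>
    have "(\<lambda>z. inv_into U \<phi> (to_plane z)) ` V = {x \<in> U. \<phi> x \<in> to_plane ` V}"
    proof
      show "(\<lambda>z. inv_into U \<phi> (to_plane z)) ` V \<subseteq> {x \<in> U. \<phi> x \<in> to_plane ` V}"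
      proof clarify
        fix z assume "z \<in> V"
        then have "to_plane z \<in> \<phi> ` U"
          using V(2) D(2) by blast
        then show "inv_into U \<phi> (to_plane z) \<in> U \<and> \<phi> (inv_into U \<phi> (to_plane z)) \<in> to_plane ` V"
          using \<open>z \<in> V\<close> by (simp add: inv_into_into f_inv_into_f)
      qed
      show "{x \<in> U. \<phi> x \<in> to_plane ` V} \<subseteq> (\<lambda>z. inv_into U \<phi> (to_plane z)) ` V"
        using inj by (auto simp: image_iff) (metis inv_into_f_f)
    qed
    moreover have "openin (top_of_set (\<phi> ` U)) (to_plane ` V)"
      using V D(2) open_image_to_plane by (intro open_subset) auto
    from openin_continuous_map_preimage [OF homeomorphic_imp_continuous_map [OF hom] this]
    have "openin (subtopology M U) {x \<in> U. \<phi> x \<in> to_plane ` V}"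
      unfolding top .
    ultimately show ?thesis
      using openin_trans_full [OF _ U] by simp
  qed
qed (use alg D in auto)

theorem theorem1p3:
  fixes M :: "'a topology" and \<A> :: "'a chart set"
  assumes "C1_surface_with_boundary M \<A>" and "compact_space M"
  shows "\<not> (\<exists>A. uniform_algebra M A \<and>
                essential_algebra M A \<and> natural_algebra M A \<and> regular_algebra M A \<and>
                (\<exists>F. (\<forall>f\<in>F. C1_smooth \<A> f) \<and> generates M F A))"
proof (intro notI, elim exE conjE)
  fix A F
  assume A: "uniform_algebra M A" "essential_algebra M A" "regular_algebra M A"
    and F: "\<forall>f\<in>F. C1_smooth \<A> f" "generates M F A"
  have atlas: "\<forall>\<kappa>\<in>\<A>. is_chart M \<kappa>" "(\<Union>\<kappa>\<in>\<A>. fst \<kappa>) = topspace M"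
    using assms(1) by (auto simp: C1_surface_with_boundary_def C1_atlas_def)
  \<comment> \<open>A chart domain may be empty; a nonempty one exists because a uniform algebra
    lives on a nonempty space, which the charts cover.\<close>
  then obtain U \<phi> where chart: "(U, \<phi>) \<in> \<A>" "is_chart M (U, \<phi>)" and "U \<noteq> {}"
    using uniform_algebra_topspace_nonempty [OF A(1)] by fastforce
  then obtain D where D: "open D" "D \<noteq> {}" "to_plane ` D \<subseteq> \<phi> ` U"
    using relatively_open_half_plane_interior [of "\<phi> ` U"] by (auto simp: is_chart_def)
  interpret regular_algebra_on_planar_piece M A D "\<lambda>z. inv_into U \<phi> (to_plane z)"
    using A chart D by (intro chart_piece) (auto simp: regular_algebra_def)
  have "\<exists>fx fy. has_C1_partials D (\<lambda>z. f (inv_into U \<phi> (to_plane z))) fx fy" if "f \<in> F" for f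
  proof -
    have "C1_on (\<phi> ` U) (f \<circ> inv_into U \<phi>)"
      using F(1) that chart(1) unfolding C1_smooth_def by fastforce
    from C1_on_imp_has_C1_partials [OF this D(1,3)] show ?thesis
      by (simp add: o_def)
  qed
  then show False
    using not_essential_if_generated_by_C1 [OF F(2) _ D(2)] A(2) by blast
qed

end
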